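(* Let $r\ge 2$ and $k\ge 1$ be integers, and let $F$ be a graph such that $\mathrm{ex}(n,F)=e(T_{n,r})+O(1)$ (i.e. $|\mathrm{ex}(n,F)-e(T_{n,r})|$ is bounded by a constant independent of $n$). Then there is $n_0$ such that for all $n\ge n_0$ the following holds: if $G$ is an $n$-vertex $kF$-free graph with the maximum possible number of edges (i.e. $e(G)=\mathrm{ex}(n,kF)$), then $G= K_{k-1}\vee G'$ for some $G'\in \mathrm{EX}(n-k+1,F)$.
   Context: All graphs are simple. For a graph $F$, $\mathrm{ex}(n,F)$ is the maximum number of edges of an $n$-vertex graph containing no copy of $F$ (as a subgraph), and $\mathrm{EX}(n,F)$ is the set of $n$-vertex $F$-free graphs with exactly $\mathrm{ex}(n,F)$ edges. $kF$ denotes the disjoint union of $k$ copies of $F$. $T_{n,r}$ is the Turán graph, the complete $r$-partite graph on $n$ vertices with part sizes as equal as possible; $e(\cdot)$ denotes the number of edges. $K_{m}$ is the complete graph on $m$ vertices ($K_0$ is the empty graph), and $G\vee H$ (the join) is obtained from the disjoint union of $G$ and $H$ by adding all edges between $V(G)$ and $V(H)$. *)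

theory Defs
  imports Main
begin

definition graph :: "'a set \<Rightarrow> 'a set set \<Rightarrow> bool" where
  "graph V E \<longleftrightarrow> finite V \<and> (\<forall>e\<in>E. \<exists>u v. u \<in> V \<and> v \<in> V \<and> u \<noteq> v \<and> e = {u, v})"

definition contains :: "'a set \<Rightarrow> 'a set set \<Rightarrow> 'b set \<Rightarrow> 'b set set \<Rightarrow> bool" where
  "contains VF EF V E \<longleftrightarrow>
     (\<exists>f. inj_on f VF \<and> f ` VF \<subseteq> V \<and> (\<forall>e\<in>EF. f ` e \<in> E))"

definition copiesV :: "nat \<Rightarrow> 'a set \<Rightarrow> ('a \<times> nat) set" where
  "copiesV k VF = VF \<times> {..<k}"

definition copiesE :: "nat \<Rightarrow> 'a set set \<Rightarrow> ('a \<times> nat) set set" where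
  "copiesE k EF = {(\<lambda>x. (x, i)) ` e | e i. e \<in> EF \<and> i < k}"

definition ex :: "nat \<Rightarrow> 'a set \<Rightarrow> 'a set set \<Rightarrow> nat" where
  "ex n VF EF = Max {card E | E. graph {..<n} E \<and> \<not> contains VF EF {..<n} E}"

definition EXgraphs :: "nat \<Rightarrow> 'a set \<Rightarrow> 'a set set \<Rightarrow> nat set set set" where
  "EXgraphs n VF EF = {E. graph {..<n} E \<and> \<not> contains VF EF {..<n} E \<and> card E = ex n VF EF}"

definition turan_edges :: "nat \<Rightarrow> nat \<Rightarrow> nat set set" where
  "turan_edges n r = {{u, v} | u v. u < n \<and> v < n \<and> u mod r \<noteq> v mod r}"

end

theory Submission
  imports Defs Complex_Main
begin

text \<open>
  Let \<open>L\<close> be the set of vertices of degree at least \<open>(1 - 1/r + \<eta>) n\<close> in an extremal \<open>kF\<close>-free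
  graph \<open>G\<close>, for a small constant \<open>\<eta>\<close>. Since \<open>K\<^sub>k\<^sub>-\<^sub>1\<close> joined to an extremal \<open>F\<close>-free graph is
  \<open>kF\<close>-free, \<open>G\<close> has at least \<open>e(T\<^sub>n\<^sub>,\<^sub>r) + (k - 1) n / r - O(1)\<close> edges. Deleting \<open>L\<close> together with
  the \<open>O(1)\<close> vertices of a maximal family of disjoint copies of \<open>F\<close> leaves an \<open>F\<close>-free graph,
  and counting edges gives \<open>card L \<ge> k - 1\<close>.

  Deleting a bounded set of low-degree vertices from \<open>G\<close> and counting edges shows that only \<open>O(1)\<close> vertices have degree below
  \<open>(1 - 1/r - \<epsilon>) n\<close>. Hence, even after the removal of \<open>O(1)\<close> further vertices, the
  neighbourhood of each \<open>v \<in> L\<close> has relative minimum degree above \<open>1 - 1/(r-1)\<close>, so by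
  Erdos--Stone it contains a complete \<open>r\<close>-partite graph with parts of size \<open>|F|\<close>. The cone over it
  contains \<open>F\<close>, because the cone over a Turan graph has too many edges to be \<open>F\<close>-free.
  If \<open>S \<subseteq> L\<close> has \<open>k - 1\<close> elements and \<open>G - S\<close> contained \<open>F\<close>, greedily chosen
  copies of \<open>F\<close> at the vertices of \<open>S\<close> would complete it to \<open>kF\<close>. So \<open>G - S\<close> is \<open>F\<close>-free, and
  comparison with the lower bound forces \<open>G\<close> to be the join of \<open>K\<^sub>k\<^sub>-\<^sub>1\<close> on \<open>S\<close> and an extremal \<open>F\<close>-free graph.
\<close>

section \<open>Graphs and copies\<close>

definition nbhd :: "'v set set \<Rightarrow> 'v \<Rightarrow> 'v set" where
  "nbhd E v = {u. {v, u} \<in> E}"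

definition induced :: "'v set \<Rightarrow> 'v set set \<Rightarrow> 'v set set" where
  "induced A E = {e \<in> E. e \<subseteq> A}"

lemma graph_edgeD:
  assumes "graph V E" "{u, v} \<in> E"
  shows "u \<in> V" "v \<in> V" "u \<noteq> v"
  using assms unfolding graph_def by (fastforce simp: doubleton_eq_iff)+

lemma graph_edge_subset: "graph V E \<Longrightarrow> e \<in> E \<Longrightarrow> e \<subseteq> V"
  unfolding graph_def by fastforce

lemma graph_finite: "graph V E \<Longrightarrow> finite V"
  by (simp add: graph_def)

lemma graph_finite_edges: "graph V E \<Longrightarrow> finite E"
  by (meson Pow_iff finite_Pow_iff finite_subset graph_edge_subset graph_finite subsetI)

lemma nbhd_subset: "graph V E \<Longrightarrow> nbhd E v \<subseteq> V"
  by (auto simp: nbhd_def dest: graph_edgeD(2))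

lemma finite_nbhd: "graph V E \<Longrightarrow> finite (nbhd E v)"
  using finite_subset[OF nbhd_subset graph_finite] .

lemma card_nbhd_le: "graph V E \<Longrightarrow> card (nbhd E v) \<le> card V"
  by (simp add: card_mono graph_finite nbhd_subset)

lemma graph_induced:
  assumes "graph V E" "A \<subseteq> V"
  shows "graph A (induced A E)"
  unfolding graph_def
proof (intro conjI ballI)
  show "finite A" using assms finite_subset graph_finite by metis
  fix e assume "e \<in> induced A E"
  then have e: "e \<in> E" "e \<subseteq> A" by (auto simp: induced_def)
  then obtain u v where "u \<noteq> v" "e = {u, v}" using assms(1) by (auto simp: graph_def)
  then show "\<exists>u v. u \<in> A \<and> v \<in> A \<and> u \<noteq> v \<and> e = {u, v}" using e(2) by auto
qed

text \<open>Edges not inside \<open>V - W\<close> have an endpoint in \<open>W\<close> and are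
  charged to it; edges inside \<open>W\<close> are charged twice, hence only an inequality.\<close>

lemma card_edges_le_induced_plus_degrees:
  assumes "graph V E" "W \<subseteq> V"
  shows "card E \<le> card (induced (V - W) E) + (\<Sum>w\<in>W. card (nbhd E w))"
proof -
  have "E \<subseteq> induced (V - W) E \<union> (\<Union>w\<in>W. (\<lambda>u. {w, u}) ` nbhd E w)"
  proof
    fix e assume e: "e \<in> E"
    then obtain u v where uv: "e = {u, v}" "u \<in> V" "v \<in> V"
      using assms(1) unfolding graph_def by blast
    show "e \<in> induced (V - W) E \<union> (\<Union>w\<in>W. (\<lambda>u. {w, u}) ` nbhd E w)"
    proof (cases "u \<in> W \<or> v \<in> W")
      case True
      then show ?thesis
      proof
        assume "u \<in> W"
        moreover have "v \<in> nbhd E u" using e uv by (simp add: nbhd_def)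
        ultimately show ?thesis using uv(1) by blast
      next
        assume "v \<in> W"
        moreover have "u \<in> nbhd E v" "e = {v, u}" using e uv by (auto simp: nbhd_def insert_commute)
        ultimately show ?thesis by blast
      qed
    next
      case False
      then show ?thesis using e uv by (auto simp: induced_def)
    qed
  qed
  moreover have fin: "finite (induced (V - W) E)" "finite W"
    using graph_finite_edges[OF assms(1)] finite_subset[OF assms(2) graph_finite[OF assms(1)]]
    by (simp_all add: induced_def)
  ultimately have "card E \<le> card (induced (V - W) E \<union> (\<Union>w\<in>W. (\<lambda>u. {w, u}) ` nbhd E w))"
    using finite_nbhd[OF assms(1)] by (intro card_mono) auto
  also have "\<dots> \<le> card (induced (V - W) E) + card (\<Union>w\<in>W. (\<lambda>u. {w, u}) ` nbhd E w)"
    by (rule card_Un_le)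
  also have "card (\<Union>w\<in>W. (\<lambda>u. {w, u}) ` nbhd E w) \<le> (\<Sum>w\<in>W. card ((\<lambda>u. {w, u}) ` nbhd E w))"
    by (rule card_UN_le[OF fin(2)])
  also have "\<dots> \<le> (\<Sum>w\<in>W. card (nbhd E w))"
    by (intro sum_mono card_image_le finite_nbhd[OF assms(1)])
  finally show ?thesis by simp
qed

section \<open>Embeddings and families of disjoint copies\<close>

lemma containsI:
  "inj_on f VF \<Longrightarrow> f ` VF \<subseteq> V \<Longrightarrow> \<forall>e\<in>EF. f ` e \<in> E \<Longrightarrow> contains VF EF V E"
  unfolding contains_def by (rule exI[of _ f]) simp

lemma containsE:
  assumes "contains VF EF V E"
  obtains f where "inj_on f VF" "f ` VF \<subseteq> V" "\<forall>e\<in>EF. f ` e \<in> E"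
proof -
  from assms obtain f where "inj_on f VF \<and> f ` VF \<subseteq> V \<and> (\<forall>e\<in>EF. f ` e \<in> E)"
    unfolding contains_def by (rule exE)
  then show ?thesis using that[of f] by simp
qed

lemma contains_mono:
  assumes "contains VF EF A E" "A \<subseteq> B" "E \<subseteq> E'"
  shows "contains VF EF B E'"
proof -
  obtain f where f: "inj_on f VF" "f ` VF \<subseteq> A" "\<forall>e\<in>EF. f ` e \<in> E"
    using assms(1) by (rule containsE)
  show ?thesis
  proof (rule containsI[OF f(1)])
    show "f ` VF \<subseteq> B" using f(2) assms(2) by (rule subset_trans)
    show "\<forall>e\<in>EF. f ` e \<in> E'" using f(3) assms(3) by (meson subsetD)
  qed
qed

lemma contains_induced:
  assumes "graph VF EF" "contains VF EF A E"
  shows "contains VF EF A (induced A E)"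
proof -
  obtain f where f: "inj_on f VF" "f ` VF \<subseteq> A" "\<forall>e\<in>EF. f ` e \<in> E"
    using assms(2) by (rule containsE)
  have "f ` e \<subseteq> A" if "e \<in> EF" for e
    using f(2) graph_edge_subset[OF assms(1) that] by (meson image_mono subset_trans)
  then show ?thesis using f by (intro containsI[of f]) (auto simp: induced_def)
qed

text \<open>Replaces the tagged vertices \<open>(x, i)\<close> of \<open>kF\<close> by
  \<open>k\<close> embeddings with disjoint images, the form in which later arguments handle
  \<open>kF\<close>.\<close>

lemma contains_copies_iff:
  "contains (copiesV k VF) (copiesE k EF) V E \<longleftrightarrow>
    (\<exists>g. (\<forall>i<k. inj_on (g i) VF \<and> g i ` VF \<subseteq> V \<and> (\<forall>e\<in>EF. g i ` e \<in> E)) \<and>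
         (\<forall>i<k. \<forall>j<k. i \<noteq> j \<longrightarrow> g i ` VF \<inter> g j ` VF = {}))"
  (is "?L \<longleftrightarrow> ?R")
proof
  assume ?L
  then obtain f where f: "inj_on f (VF \<times> {..<k})" "f ` (VF \<times> {..<k}) \<subseteq> V"
    and edges: "\<forall>e\<in>copiesE k EF. f ` e \<in> E"
    unfolding contains_def copiesV_def by (elim exE conjE)
  have f3: "f ` (\<lambda>x. (x, i)) ` e \<in> E" if "e \<in> EF" "i < k" for e i
    using edges that by (auto simp: copiesE_def)
  define g where "g i x = f (x, i)" for i x
  have "g i ` e = f ` (\<lambda>x. (x, i)) ` e" for i e
    by (auto simp: g_def)
  moreover have "inj_on (g i) VF" if "i < k" for i
    using f(1) that by (auto simp: g_def inj_on_def)
  moreover have "g i ` VF \<subseteq> V" if "i < k" for i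
    using f(2) that by (auto simp: g_def)
  moreover have "g i ` VF \<inter> g j ` VF = {}" if "i < k" "j < k" "i \<noteq> j" for i j
    using f(1) that by (fastforce simp: g_def inj_on_def)
  ultimately show ?R using f3 by (intro exI[of _ g]) simp
next
  assume ?R
  then obtain g where g0: "\<forall>i<k. inj_on (g i) VF \<and> g i ` VF \<subseteq> V \<and> (\<forall>e\<in>EF. g i ` e \<in> E)"
     "\<forall>i<k. \<forall>j<k. i \<noteq> j \<longrightarrow> g i ` VF \<inter> g j ` VF = {}"
    by (elim exE conjE)
  have g: "inj_on (g i) VF" "g i ` VF \<subseteq> V" "e \<in> EF \<Longrightarrow> g i ` e \<in> E" if "i < k" for i e
    using g0(1) that by simp_all
  have g4: "g i ` VF \<inter> g j ` VF = {}" if "i < k" "j < k" "i \<noteq> j" for i j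
    using g0(2) that by simp
  define f where "f = (\<lambda>(x, i). g i x)"
  have "inj_on f (VF \<times> {..<k})"
  proof (rule inj_onI, clarsimp simp: f_def)
    fix x i y j assume *: "x \<in> VF" "i < k" "y \<in> VF" "j < k" "g i x = g j y"
    then have "i = j" using g4[of i j] by blast
    then show "x = y \<and> i = j" using * g(1)[of i] by (auto simp: inj_on_def)
  qed
  moreover have "f ` (VF \<times> {..<k}) \<subseteq> V"
    using g(2) by (force simp: f_def)
  moreover have "f ` e \<in> E" if e_in: "e \<in> copiesE k EF" for e
  proof -
    obtain e' i where e: "e = (\<lambda>x. (x, i)) ` e'" "e' \<in> EF" "i < k"
      using e_in unfolding copiesE_def by (elim CollectE exE conjE)
    have "f ` e = g i ` e'" unfolding e(1) by (auto simp: f_def image_iff)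
    then show ?thesis using g(3)[OF e(3) e(2)] by simp
  qed
  ultimately show ?L by (intro containsI[of f]) (simp_all add: copiesV_def)
qed

lemma contains_copies_Suc:
  assumes "inj_on f VF" "f ` VF \<subseteq> V" "\<forall>e\<in>EF. f ` e \<in> E"
    and "contains (copiesV k VF) (copiesE k EF) (V - f ` VF) E"
  shows "contains (copiesV (Suc k) VF) (copiesE (Suc k) EF) V E"
proof -
  obtain g where g: "\<forall>i<k. inj_on (g i) VF \<and> g i ` VF \<subseteq> V - f ` VF \<and> (\<forall>e\<in>EF. g i ` e \<in> E)"
     "\<forall>i<k. \<forall>j<k. i \<noteq> j \<longrightarrow> g i ` VF \<inter> g j ` VF = {}"
    using assms(4) unfolding contains_copies_iff by (elim exE conjE)
  define g' where "g' = g(k := f)"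
  have "inj_on (g' i) VF \<and> g' i ` VF \<subseteq> V \<and> (\<forall>e\<in>EF. g' i ` e \<in> E)" if "i < Suc k" for i
  proof (cases "i = k")
    case True
    then show ?thesis using assms(1-3) by (simp add: g'_def)
  next
    case False
    then have "i < k" using that by simp
    then show ?thesis using g(1) False by (auto simp: g'_def)
  qed
  moreover have "g' i ` VF \<inter> g' j ` VF = {}" if "i < Suc k" "j < Suc k" "i \<noteq> j" for i j
  proof -
    consider "i < k" "j < k" | "i = k" "j < k" | "i < k" "j = k"
      using \<open>i < Suc k\<close> \<open>j < Suc k\<close> \<open>i \<noteq> j\<close> by (metis less_SucE)
    then show ?thesis
    proof cases
      case 1
      then show ?thesis using g(2) that by (simp add: g'_def)
    next
      case 2
      then have "g j ` VF \<subseteq> V - f ` VF" using g(1) by simp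
      then show ?thesis using 2 by (auto simp: g'_def)
    next
      case 3
      then have "g i ` VF \<subseteq> V - f ` VF" using g(1) by simp
      then show ?thesis using 3 by (auto simp: g'_def)
    qed
  qed
  ultimately show ?thesis unfolding contains_copies_iff by (intro exI[of _ g']) simp
qed

text \<open>Greedy deletion: the vertices of one copy of \<open>F\<close> go into \<open>W\<close>,
  and what is left has no \<open>k\<close> disjoint copies if the whole had no
  \<open>Suc k\<close>.\<close>

lemma exists_hitting_set:
  assumes "finite VF" "finite A" "\<not> contains (copiesV k VF) (copiesE k EF) A E"
  shows "\<exists>W\<subseteq>A. card W \<le> k * card VF \<and> \<not> contains VF EF (A - W) E"
  using assms(2,3)
proof (induction k arbitrary: A)
  case 0
  \<comment> \<open>\<open>0F\<close> has no vertices and lies in every graph, so the hypothesis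
    fails.\<close>
  then show ?case by (auto simp: contains_copies_iff)
next
  case (Suc k)
  show ?case
  proof (cases "contains VF EF A E")
    case True
    then obtain f where f: "inj_on f VF" "f ` VF \<subseteq> A" "\<forall>e\<in>EF. f ` e \<in> E"
      by (rule containsE)
    then have "\<not> contains (copiesV k VF) (copiesE k EF) (A - f ` VF) E"
      using Suc.prems(2) contains_copies_Suc[OF f] by metis
    then obtain W where W: "W \<subseteq> A - f ` VF" "card W \<le> k * card VF"
        "\<not> contains VF EF (A - f ` VF - W) E"
      using Suc.IH[of "A - f ` VF"] Suc.prems(1) by auto
    have "card (f ` VF \<union> W) \<le> card VF + k * card VF"
      using card_Un_le[of "f ` VF" W] card_image_le[OF assms(1), of f] W(2) by linarith
    moreover have "A - f ` VF - W = A - (f ` VF \<union> W)" by blast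
    moreover have "f ` VF \<union> W \<subseteq> A" using f(2) W(1) by blast
    ultimately show ?thesis using W(3)
      by (intro exI[of _ "f ` VF \<union> W"]) simp
  next
    case False
    then show ?thesis by (intro exI[of _ "{}"]) auto
  qed
qed

lemma contains_copies_of_rich_vertices:
  assumes "finite VF" "finite S"
    and rich: "\<forall>v\<in>S. \<forall>X. finite X \<longrightarrow> v \<notin> X \<longrightarrow> card X \<le> M \<longrightarrow> contains VF EF (V - X) E"
    and "finite X" "S \<inter> X = {}" "card X + card S * (card VF + 1) \<le> M"
  shows "contains (copiesV (card S) VF) (copiesE (card S) EF) (V - X) E"
  using assms(2-)
proof (induction S arbitrary: X rule: finite_induct)
  case empty
  then show ?case by (simp add: contains_copies_iff)
next
  case (insert v S)
  have card: "card (X \<union> S) \<le> M"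
    using card_Un_le[of X S] insert.prems(4) insert.hyps by (simp add: algebra_simps)
  have "finite (X \<union> S)" "v \<notin> X \<union> S"
    using insert.prems insert.hyps by auto
  then have "contains VF EF (V - (X \<union> S)) E"
    using insert.prems(1) card by blast
  then obtain f where f: "inj_on f VF" "f ` VF \<subseteq> V - (X \<union> S)" "\<forall>e\<in>EF. f ` e \<in> E"
    by (rule containsE)
  have "card (X \<union> f ` VF) \<le> card X + card VF"
    using card_Un_le[of X "f ` VF"] card_image_le[OF assms(1), of f] by linarith
  then have "card (X \<union> f ` VF) + card S * (card VF + 1) \<le> M"
    using insert.prems(4) insert.hyps by (simp add: algebra_simps)
  moreover have "S \<inter> (X \<union> f ` VF) = {}" "finite (X \<union> f ` VF)"
    using insert.prems(2,3) f(2) assms(1) by auto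
  ultimately have "contains (copiesV (card S) VF) (copiesE (card S) EF) (V - (X \<union> f ` VF)) E"
    using insert.prems(1) by (intro insert.IH) simp_all
  then have "contains (copiesV (card S) VF) (copiesE (card S) EF) (V - X - f ` VF) E"
    by (simp add: Diff_Un Diff_Int_distrib2 Diff_eq Int_assoc)
  moreover have "f ` VF \<subseteq> V - X" using f(2) by blast
  ultimately have "contains (copiesV (Suc (card S)) VF) (copiesE (Suc (card S)) EF) (V - X) E"
    using f(1,3) by (intro contains_copies_Suc[of f])
  then show ?case using insert.hyps by simp
qed

section \<open>Extremal numbers and Turan graphs\<close>

lemma finite_ex_candidates:
  fixes n :: nat
  shows "finite {card E | E. graph {..<n} E \<and> \<not> contains VF EF {..<n} E}"
proof -
  have "{E. graph {..<n} E \<and> \<not> contains VF EF {..<n} E} \<subseteq> Pow (Pow {..<n})"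
    using graph_edge_subset by blast
  then have "finite {E. graph {..<n} E \<and> \<not> contains VF EF {..<n} E}"
    by (rule finite_subset) simp
  from finite_imageI[OF this, of card] show ?thesis
    by (simp add: image_Collect)
qed

lemma card_le_ex:
  "graph {..<n} E \<Longrightarrow> \<not> contains VF EF {..<n} E \<Longrightarrow> card E \<le> ex n VF EF"
  unfolding ex_def by (rule Max_ge[OF finite_ex_candidates]) blast

text \<open>An edge of \<open>F\<close> makes the edgeless graph \<open>F\<close>-free, so the set
  under \<open>Max\<close> is nonempty and its maximum is attained.\<close>

lemma EXgraphs_nonempty:
  assumes "EF \<noteq> {}"
  shows "EXgraphs n VF EF \<noteq> {}"
proof -
  have "graph {..<n} {}" "\<not> contains VF EF {..<n} {}"
    using assms by (auto simp: graph_def contains_def)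
  then have "card ({} :: nat set set) \<in> {card E | E. graph {..<n} E \<and> \<not> contains VF EF {..<n} E}"
    by (intro CollectI exI[of _ "{}"] conjI refl)
  then have "{card E | E. graph {..<n} E \<and> \<not> contains VF EF {..<n} E} \<noteq> {}"
    by (metis empty_iff)
  from Max_in[OF finite_ex_candidates this]
  have "\<exists>E. ex n VF EF = card E \<and> graph {..<n} E \<and> \<not> contains VF EF {..<n} E"
    unfolding ex_def by (rule CollectD)
  then obtain E where "ex n VF EF = card E \<and> graph {..<n} E \<and> \<not> contains VF EF {..<n} E"
    by (rule exE)
  then have "E \<in> EXgraphs n VF EF" unfolding EXgraphs_def by simp
  then show ?thesis by (metis empty_iff)
qed

section \<open>Relabelling of vertices\<close>

lemma graph_image:
  assumes "graph V E" "inj_on f V"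
  shows "graph (f ` V) ((`) f ` E)"
proof -
  have "\<exists>u v. u \<in> f ` V \<and> v \<in> f ` V \<and> u \<noteq> v \<and> f ` e = {u, v}" if e: "e \<in> E" for e
  proof -
    obtain u v where uv: "u \<in> V" "v \<in> V" "u \<noteq> v" "e = {u, v}"
      using assms(1) e by (auto simp: graph_def)
    then have "f u \<noteq> f v" using assms(2) by (auto dest: inj_onD)
    then show ?thesis using uv
      by (intro exI[of _ "f u"] exI[of _ "f v"]) simp
  qed
  then show ?thesis using graph_finite[OF assms(1)] by (simp add: graph_def)
qed

lemma card_image_edges:
  assumes "graph V E" "inj_on f V"
  shows "card ((`) f ` E) = card E"
proof (rule card_image, rule inj_on_subset[OF inj_on_image_Pow[OF assms(2)]])
  show "E \<subseteq> Pow V" using graph_edge_subset[OF assms(1)] by auto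
qed

lemma contains_of_contains_image:
  assumes "graph V E" "inj_on f V" "contains VF EF (f ` V) ((`) f ` E)"
  shows "contains VF EF V E"
proof -
  obtain g where g: "inj_on g VF" "g ` VF \<subseteq> f ` V" "\<forall>e\<in>EF. g ` e \<in> (`) f ` E"
    using assms(3) by (rule containsE)
  define h where "h = inv_into V f \<circ> g"
  have "inj_on h VF"
    unfolding h_def using g(1,2) by (intro comp_inj_on inj_on_inv_into)
  moreover have "h x \<in> V" if "x \<in> VF" for x
    using g(2) that by (auto simp: h_def intro!: inv_into_into)
  moreover have "h ` e \<in> E" if e: "e \<in> EF" for e
  proof -
    obtain e' where e': "e' \<in> E" "g ` e = f ` e'" using g(3) e by (meson imageE)
    have "h ` e = inv_into V f ` f ` e'" unfolding h_def image_comp [symmetric] e'(2) ..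
    also have "\<dots> = e'" using assms(2) graph_edge_subset[OF assms(1) e'(1)] by (rule inv_into_image_cancel)
    finally show ?thesis using e'(1) by simp
  qed
  ultimately show "contains VF EF V E" by (intro containsI[of h]) auto
qed

text \<open>\<open>ex\<close> speaks of graphs on \<open>{..<n}\<close> only, so the induced graph
  is moved there along a bijection, which preserves \<open>F\<close>-freeness and the number of
  edges.\<close>

lemma card_induced_le_ex:
  assumes "graph V E" "A \<subseteq> V" "\<not> contains VF EF A E"
  shows "card (induced A E) \<le> ex (card A) VF EF"
proof -
  have finA: "finite A" using assms(1,2) by (metis finite_subset graph_finite)
  obtain f where f: "bij_betw f A {..<card A}"
    using ex_bij_betw_finite_nat[OF finA] by (auto simp: atLeast0LessThan)
  have gA: "graph A (induced A E)" using assms(1,2) by (rule graph_induced)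
  have inj: "inj_on f A" and im: "f ` A = {..<card A}" using f by (auto simp: bij_betw_def)
  have "\<not> contains VF EF A (induced A E)"
    using assms(3) contains_mono[of VF EF A "induced A E" A E] by (auto simp: induced_def)
  then have "\<not> contains VF EF (f ` A) ((`) f ` induced A E)"
    using contains_of_contains_image[OF gA inj] by metis
  then show ?thesis
    using card_le_ex[of "card A" "(`) f ` induced A E" VF EF] graph_image[OF gA inj]
      card_image_edges[OF gA inj] im by simp
qed

section \<open>Edge counts of Turan graphs\<close>

lemma finite_turan_edges: "finite (turan_edges n r)"
  by (rule finite_subset[of _ "Pow {..<n}"]) (auto simp: turan_edges_def)

text \<open>These are the old vertices in the class of a new vertex \<open>n\<close>; they are
  \<open>n mod r + j * r\<close> for \<open>j < n div r\<close>.\<close>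

lemma card_residue_class: 
  fixes n r :: nat
  assumes "r > 0"
  shows "card {u. u < n \<and> u mod r = n mod r} = n div r"
proof -
  have "bij_betw (\<lambda>j. n mod r + j * r) {..<n div r} {u. u < n \<and> u mod r = n mod r}"
  proof (rule bij_betw_imageI)
    show "inj_on (\<lambda>j. n mod r + j * r) {..<n div r}"
      using assms by (auto simp: inj_on_def)
    show "(\<lambda>j. n mod r + j * r) ` {..<n div r} = {u. u < n \<and> u mod r = n mod r}" (is "?f ` _ = ?B")
    proof (intro equalityI subsetI)
      fix u assume "u \<in> ?f ` {..<n div r}"
      then obtain j where j: "j < n div r" "u = n mod r + j * r" by auto
      have "j * r < n div r * r" using j(1) assms by simp
      then have "u < n" using j(2) div_mult_mod_eq[of n r] by linarith
      then show "u \<in> ?B" using j(2) by simp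
    next
      fix u assume "u \<in> ?B"
      then have u: "u < n" "u mod r = n mod r" by auto
      have "u div r * r + n mod r < n div r * r + n mod r"
        using u div_mult_mod_eq[of u r] div_mult_mod_eq[of n r] by linarith
      then have "u div r * r < n div r * r" by (simp only: add_less_cancel_right)
      then have "u div r < n div r" by (metis mult_less_cancel2)
      moreover have "u = ?f (u div r)" using u(2) mod_mult_div_eq[of u r] by (simp add: mult.commute)
      ultimately show "u \<in> ?f ` {..<n div r}" by blast
    qed
  qed
  from bij_betw_same_card[OF this] show ?thesis by simp
qed

text \<open>The new vertex \<open>n\<close> is joined to everything outside its residue
  class.\<close>

lemma card_turan_edges_Suc:
  assumes "r > 0"
  shows "card (turan_edges (Suc n) r) = card (turan_edges n r) + (n - n div r)"
proof -
  let ?N = "{u. u < n \<and> u mod r \<noteq> n mod r}"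
  have eq: "turan_edges (Suc n) r = turan_edges n r \<union> (\<lambda>u. {u, n}) ` ?N"
  proof (intro equalityI subsetI)
    fix e assume "e \<in> turan_edges (Suc n) r"
    then obtain u v where e: "e = {u, v}" "u < Suc n" "v < Suc n" "u mod r \<noteq> v mod r"
      by (auto simp: turan_edges_def)
    consider "u < n" "v < n" | "u < n" "v = n" | "u = n" "v < n"
      using e by (metis less_SucE)
    then show "e \<in> turan_edges n r \<union> (\<lambda>u. {u, n}) ` ?N"
    proof cases
      case 1
      then show ?thesis using e by (auto simp: turan_edges_def)
    next
      case 2
      then have "u \<in> ?N" "e = {u, n}" using e by auto
      then show ?thesis by blast
    next
      case 3
      then have "v \<in> ?N" "e = {v, n}" using e by auto
      then show ?thesis by blast
    qed
  next
    fix e assume "e \<in> turan_edges n r \<union> (\<lambda>u. {u, n}) ` ?N"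
    then show "e \<in> turan_edges (Suc n) r"
      unfolding turan_edges_def using less_SucI by blast
  qed
  have "card ((\<lambda>u. {u, n}) ` ?N) = card ?N"
    by (rule card_image) (auto simp: inj_on_def doubleton_eq_iff)
  also have "card ?N = card ({..<n} - {u. u < n \<and> u mod r = n mod r})"
    by (rule arg_cong[of _ _ card]) auto
  also have "\<dots> = n - n div r"
    by (subst card_Diff_subset) (auto simp: card_residue_class[OF assms])
  finally have card: "card ((\<lambda>u. {u, n}) ` ?N) = n - n div r" .
  have "turan_edges n r \<inter> (\<lambda>u. {u, n}) ` ?N = {}"
    by (auto simp: turan_edges_def doubleton_eq_iff)
  then show ?thesis unfolding eq using finite_turan_edges[of n r]
    by (subst card_Un_disjoint) (simp_all add: card)
qed

lemma real_card_turan_edges_Suc: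
  assumes "r > 0"
  shows "(1 - 1 / r) * n \<le> real (card (turan_edges (Suc n) r)) - card (turan_edges n r)"
    and "real (card (turan_edges (Suc n) r)) - card (turan_edges n r) \<le> (1 - 1 / r) * n + 1"
proof -
  have "real (n - n div r) = real n - real (n div r)"
    by (simp add: of_nat_diff div_le_dividend)
  moreover have "real n = real r * real (n div r) + real (n mod r)"
    by (metis mult_div_mod_eq of_nat_add of_nat_mult)
  then have "real (n div r) \<le> real n / real r" "real n / real r \<le> real (n div r) + 1"
    using assms mod_less_divisor[OF assms, of n] by (simp_all add: field_simps)
  ultimately show "(1 - 1 / r) * n \<le> real (card (turan_edges (Suc n) r)) - card (turan_edges n r)"
    "real (card (turan_edges (Suc n) r)) - card (turan_edges n r) \<le> (1 - 1 / r) * n + 1"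
    unfolding card_turan_edges_Suc[OF assms] of_nat_add by (simp_all add: left_diff_distrib)
qed

text \<open>Adds up \<open>m\<close> increments, each bounded below with \<open>n\<close> and above
  with \<open>n + m\<close> in place of the current number of vertices.\<close>

lemma card_turan_edges_add:
  assumes "r > 0"
  shows "real (card (turan_edges n r)) + real m * ((1 - 1 / real r) * real n) \<le> real (card (turan_edges (n + m) r))"
    and "real (card (turan_edges (n + m) r)) \<le> real (card (turan_edges n r)) + real m * ((1 - 1 / real r) * real (n + m) + 1)"
proof -
  have r: "0 \<le> 1 - 1 / real r" using assms by simp
  show "real (card (turan_edges n r)) + real m * ((1 - 1 / real r) * real n) \<le> real (card (turan_edges (n + m) r))"
  proof (induction m)
    case (Suc m)
    have "(1 - 1 / r) * n \<le> (1 - 1 / r) * (n + m)"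
      using r by (intro mult_left_mono) auto
    then show ?case using Suc real_card_turan_edges_Suc(1)[OF assms, of "n + m"]
      by (simp add: distrib_right)
  qed simp
  show "real (card (turan_edges (n + m) r)) \<le> real (card (turan_edges n r)) + real m * ((1 - 1 / real r) * real (n + m) + 1)"
  proof (induction m)
    case (Suc m)
    have "(1 - 1 / r) * (n + m) \<le> (1 - 1 / r) * (n + Suc m)"
      using r by (intro mult_left_mono) auto
    then have "m * ((1 - 1 / r) * (n + m) + 1) \<le> m * ((1 - 1 / r) * (n + Suc m) + 1)"
      "(1 - 1 / r) * (n + m) \<le> (1 - 1 / r) * (n + Suc m)"
      using r by (intro mult_left_mono; simp)+
    then show ?case using Suc real_card_turan_edges_Suc(2)[OF assms, of "n + m"]
      by (simp only: add_Suc_right of_nat_Suc distrib_right mult_1)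
  qed simp
qed

lemma card_turan_edges_mono: "m \<le> n \<Longrightarrow> card (turan_edges m r) \<le> card (turan_edges n r)"
  by (rule card_mono[OF finite_turan_edges]) (fastforce simp: turan_edges_def)

lemma le_card_turan_edges:
  assumes "r \<ge> 2"
  shows "n \<le> card (turan_edges (Suc n) r)"
proof (induction n)
  case (Suc n)
  have "Suc n div r < Suc n" using assms by simp
  then have "Suc n - Suc n div r \<ge> 1" by linarith
  then show ?case using Suc card_turan_edges_Suc[of r "Suc n"] assms by simp
qed simp

text \<open>If \<open>F\<close> had no edges, the set in the definition of \<open>ex\<close> would be empty for large \<open>n\<close>,
  and \<open>ex\<close> would take the constant value \<open>Max {}\<close>.\<close>

lemma edges_nonempty_of_ex_near_turan:
  fixes VF :: "'a set" and C :: real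
  assumes "r \<ge> 2" "graph VF EF"
    and near: "\<And>n. \<bar>real (ex n VF EF) - card (turan_edges n r)\<bar> \<le> C"
  shows "EF \<noteq> {}"
proof
  assume EF: "EF = {}"
  have "contains VF EF {..<n} E" if "card VF \<le> n" for n and E :: "nat set set"
  proof -
    obtain f where f: "bij_betw f VF {..<card VF}"
      using ex_bij_betw_finite_nat[OF graph_finite[OF assms(2)]] by (auto simp: atLeast0LessThan)
    then have "f ` VF \<subseteq> {..<n}" using that by (auto simp: bij_betw_def)
    then show ?thesis using f EF by (intro containsI[of f]) (auto simp: bij_betw_def)
  qed
  then have const: "ex n VF EF = Max {}" if "card VF \<le> n" for n
    unfolding ex_def using that by (simp cong: conj_cong)
  \<comment> \<open>Large enough for \<open>ex\<close> to be constant at \<open>Suc n\<close>, and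
    for \<open>n\<close>, a lower bound on the Turan count there, to exceed that constant by more
    than \<open>C\<close>.\<close>
  define n where "n = card VF + nat \<lceil>\<bar>C\<bar>\<rceil> + Max {} + 1"
  have "real n \<le> card (turan_edges (Suc n) r)" using le_card_turan_edges[OF assms(1), of n] by simp
  moreover have "ex (Suc n) VF EF = Max {}" by (rule const) (simp add: n_def)
  moreover have "real n > \<bar>C\<bar> + real (Max {})"
    unfolding n_def by linarith
  ultimately show False using near[of "Suc n"] by linarith
qed

text \<open>Pigeonhole over the \<open>2 ^ card P\<close> possible values of
  \<open>\<phi>\<close>.\<close>

lemma exists_large_fibre:
  assumes "finite U" "finite P" "\<And>u. u \<in> U \<Longrightarrow> \<phi> u \<subseteq> P" "card U > t * 2 ^ card P"
  shows "\<exists>B\<subseteq>P. card {u \<in> U. \<phi> u = B} \<ge> t"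
proof (rule ccontr)
  assume *: "\<not> ?thesis"
  have "U = (\<Union>B\<in>Pow P. {u \<in> U. \<phi> u = B})" using assms(3) by auto
  then have "card U \<le> (\<Sum>B\<in>Pow P. card {u \<in> U. \<phi> u = B})"
    using card_UN_le[of "Pow P" "\<lambda>B. {u \<in> U. \<phi> u = B}"] assms(2) by simp
  also have "\<dots> \<le> (\<Sum>B\<in>Pow P. t)"
    using * by (intro sum_mono) (auto simp: not_le less_imp_le)
  also have "\<dots> = t * 2 ^ card P" using assms(2) by (simp add: card_Pow)
  finally show False using assms(4) by simp
qed

section \<open>Complete multipartite subgraphs\<close>

text \<open>A subgraph notion: edges inside a part are allowed. In a simple graph the parts are
  automatically disjoint, since a common vertex would be a loop.\<close>

definition multipartite :: "'v set set \<Rightarrow> nat \<Rightarrow> nat \<Rightarrow> (nat \<Rightarrow> 'v set) \<Rightarrow> bool" where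
  "multipartite E r t P \<longleftrightarrow> (\<forall>i<r. finite (P i) \<and> card (P i) = t) \<and>
     (\<forall>i<r. \<forall>j<r. i \<noteq> j \<longrightarrow> (\<forall>x\<in>P i. \<forall>y\<in>P j. {x, y} \<in> E))"

lemma multipartite_edge:
  "multipartite E r t P \<Longrightarrow> i < r \<Longrightarrow> j < r \<Longrightarrow> i \<noteq> j \<Longrightarrow> x \<in> P i \<Longrightarrow> y \<in> P j \<Longrightarrow> {x, y} \<in> E"
  by (simp add: multipartite_def)

section \<open>The minimum-degree form of the Erdos-Stone theorem\<close>

lemma mem_nbhd_commute: "u \<in> nbhd E v \<longleftrightarrow> v \<in> nbhd E u"
  by (simp add: nbhd_def insert_commute)

text \<open>Double counting of the non-adjacent pairs between \<open>A\<close> and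
  \<open>B\<close>.\<close>

lemma sum_card_nonneighbours_swap:
  assumes "finite A" "finite B"
  shows "(\<Sum>u\<in>A. card (B - nbhd E u)) = (\<Sum>u\<in>B. card (A - nbhd E u))"
proof -
  have card: "card (B - nbhd E u) = (\<Sum>w\<in>B. if w \<in> nbhd E u then 0 else 1)" if "finite B" for B :: "'a set" and u
    using that by (simp add: sum.If_cases Diff_eq)
  show ?thesis
    unfolding card[OF assms(1)] card[OF assms(2)]
    by (subst sum.swap) (simp add: mem_nbhd_commute cong: sum.cong)
qed

text \<open>The induction step of the minimum-degree form of the Erdos--Stone theorem: counting non-edges,
  a fraction \<open>c / 2\<close> of the vertices of \<open>D\<close> have \<open>t\<close> neighbours in every part \<open>P i\<close>, and by
  pigeonhole \<open>t\<close> of them share their neighbourhood in the union of the parts.\<close>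

lemma multipartite_extend:
  fixes c q :: real
  assumes "finite D" and P: "multipartite E r s P" "\<And>i. i < r \<Longrightarrow> P i \<subseteq> D"
    and q: "\<And>u. u \<in> D \<Longrightarrow> card (D - nbhd E u) \<le> q" "r * q \<le> (1 - c) * card D"
    and c: "t < s" "2 * t \<le> c * s" "0 < c"
    and large: "(t + 1) * 2 ^ (r * s) < c / 2 * card D"
  shows "\<exists>P'. multipartite E (Suc r) t P' \<and> (\<forall>i<Suc r. P' i \<subseteq> D)"
proof -
  define Q where "Q = (\<Union>i<r. P i)"
  define U where "U = {u \<in> D. \<forall>i<r. t \<le> card (P i \<inter> nbhd E u)}"
  have finP: "finite (P i)" "card (P i) = s" if "i < r" for i
    using P(1) that by (auto simp: multipartite_def)
  have Q: "finite Q" "Q \<subseteq> D" using finP P(2) by (auto simp: Q_def)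
  have cardQ: "card Q \<le> r * s"
    using card_UN_le[of "{..<r}" P] finP by (simp add: Q_def)
  have m: "card D > 0" 
  proof (rule ccontr)
    assume "\<not> ?thesis"
    then have "card D = 0" by simp
    then have "(real t + 1) * 2 ^ (r * s) < 0" using large by simp
    moreover have "0 \<le> (real t + 1) * 2 ^ (r * s)" by simp
    ultimately show False by linarith
  qed
  then obtain u0 where u0: "u0 \<in> D" by (metis card_gt_0_iff ex_in_conv)
  have q0: "0 \<le> q" using q(1)[OF u0] of_nat_0_le_iff order_trans by blast
  \<comment> \<open>A vertex outside \<open>U\<close> has fewer than \<open>t\<close> neighbours in
    some \<open>P i\<close>, so it misses more than \<open>s - t\<close> of the \<open>s\<close>
    vertices there.\<close>
  have miss: "s - t \<le> card (Q - nbhd E u)" if u: "u \<in> D - U" for u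
  proof -
    obtain i where i: "i < r" "card (P i \<inter> nbhd E u) < t"
      using u by (auto simp: U_def not_le)
    have "card (P i - nbhd E u) = s - card (P i \<inter> nbhd E u)"
      using finP[OF i(1)] by (simp add: card_Diff_subset_Int)
    moreover have "card (P i - nbhd E u) \<le> card (Q - nbhd E u)"
      using Q(1) i(1) by (intro card_mono) (auto simp: Q_def)
    ultimately show ?thesis using i(2) by linarith
  qed
  \<comment> \<open>Non-adjacent pairs between \<open>D\<close> and \<open>Q\<close>: at least
    \<open>s - t\<close> at each vertex of \<open>D - U\<close>, at most \<open>q\<close> at each
    vertex of \<open>Q\<close>.\<close>
  have "real (card (D - U)) * (real s - t) = (\<Sum>u\<in>D - U. real (s - t))"
    using c(1) by (simp add: of_nat_diff)
  also have "\<dots> \<le> (\<Sum>u\<in>D - U. real (card (Q - nbhd E u)))"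
    using miss by (intro sum_mono) (simp only: of_nat_le_iff)
  also have "\<dots> \<le> (\<Sum>u\<in>D. real (card (Q - nbhd E u)))"
    using assms(1) by (intro sum_mono2) auto
  also have "\<dots> = (\<Sum>u\<in>Q. real (card (D - nbhd E u)))"
    using sum_card_nonneighbours_swap[OF assms(1) Q(1), of E] by (simp flip: of_nat_sum)
  also have "\<dots> \<le> (\<Sum>u\<in>Q. q)"
    using Q(2) q(1) by (intro sum_mono) auto
  also have "\<dots> = card Q * q" by simp
  also have "\<dots> \<le> (r * s) * q"
    using cardQ q0 by (intro mult_right_mono) (simp_all flip: of_nat_mult)
  also have "\<dots> = s * (r * q)" by simp
  also have "\<dots> \<le> s * ((1 - c) * card D)"
    using q(2) by (intro mult_left_mono) auto
  finally have count: "real (card (D - U)) * (real s - t) \<le> s * ((1 - c) * card D)" .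
  have U: "U \<subseteq> D" "finite U" using assms(1) by (auto simp: U_def)
  have cardU: "c / 2 * card D \<le> card U"
  proof (rule ccontr)
    assume "\<not> ?thesis"
    then have *: "(1 - c / 2) * card D < card (D - U)"
      using card_Diff_subset[OF U(2,1)] card_mono[OF assms(1) U(1)] by (simp add: of_nat_diff algebra_simps)
    \<comment> \<open>By \<open>2 * t \<le> c * s\<close>, replacing \<open>s\<close> by
      \<open>s - t\<close> costs at most half of the margin \<open>c\<close>.\<close>
    have "real s * (1 - c) \<le> (1 - c / 2) * (real s - t)"
    proof -
      have "0 \<le> c * real t" using c(3) by simp
      then show ?thesis using c(2) by (simp add: algebra_simps diff_divide_distrib)
    qed
    then have "real s * (1 - c) * card D \<le> (1 - c / 2) * (real s - t) * card D"
      by (rule mult_right_mono) simp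
    also have "\<dots> = (1 - c / 2) * card D * (real s - t)" by simp
    also have "\<dots> < card (D - U) * (real s - t)"
      using * c(1) by (intro mult_strict_right_mono) auto
    finally show False using count by (simp add: mult.assoc)
  qed
  \<comment> \<open>\<open>Suc t\<close> instead of \<open>t\<close> makes the fibre nonempty even
    for \<open>t = 0\<close>; its member \<open>w\<close> shows that the common neighbourhood
    \<open>B\<close> meets every \<open>P i\<close> in at least \<open>t\<close> vertices.\<close>
  have "Suc t * 2 ^ card Q < card U"
  proof -
    have "Suc t * 2 ^ card Q \<le> (t + 1) * 2 ^ (r * s)"
      using cardQ by (intro mult_mono power_increasing) auto
    then have "real (Suc t * 2 ^ card Q) \<le> real ((t + 1) * 2 ^ (r * s))"
      by (rule of_nat_mono)
    also have "\<dots> < card U" using large cardU by (simp add: algebra_simps)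
    finally show ?thesis by (simp only: of_nat_less_iff)
  qed
  from exists_large_fibre[OF U(2) Q(1) _ this, of "\<lambda>u. Q \<inter> nbhd E u"]
  obtain B where B: "Suc t \<le> card {u \<in> U. Q \<inter> nbhd E u = B}" by auto
  define T where "T = {u \<in> U. Q \<inter> nbhd E u = B}"
  have T: "Suc t \<le> card T" using B by (simp add: T_def)
  then obtain T' where T': "T' \<subseteq> T" "card T' = t" "finite T'"
    using obtain_subset_with_card_n[of t T] by auto
  obtain w where w: "w \<in> T" using T by (metis card.empty ex_in_conv not_less_eq_eq zero_le)
  have "\<exists>A. A \<subseteq> P i \<inter> B \<and> card A = t \<and> finite A" if i: "i < r" for i
  proof -
    have "P i \<inter> nbhd E w = P i \<inter> B" using w i by (auto simp: T_def Q_def)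
    then have "t \<le> card (P i \<inter> B)" using w i by (auto simp: T_def U_def)
    then show ?thesis using obtain_subset_with_card_n[of t "P i \<inter> B"] by metis
  qed
  then obtain A where A: "\<And>i. i < r \<Longrightarrow> A i \<subseteq> P i \<inter> B \<and> card (A i) = t \<and> finite (A i)" by metis
  define P' where "P' i = (if i < r then A i else T')" for i
  have AT: "{x, y} \<in> E" "{y, x} \<in> E" if "i < r" "x \<in> A i" "y \<in> T'" for i x y
  proof -
    have "x \<in> nbhd E y" using A[OF that(1)] that(2,3) T'(1) by (auto simp: T_def)
    then show "{x, y} \<in> E" "{y, x} \<in> E" by (simp_all add: nbhd_def insert_commute)
  qed
  have "{x, y} \<in> E" if ij: "i < Suc r" "j < Suc r" "i \<noteq> j" "x \<in> P' i" "y \<in> P' j" for i j x y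
  proof (cases "i < r")
    case True
    show ?thesis
    proof (cases "j < r")
      case j: True
      have "x \<in> P i" "y \<in> P j" using A[OF True] A[OF j] ij True j by (auto simp: P'_def)
      then show ?thesis using P(1) True j ij(3) by (simp add: multipartite_def)
    next
      case False
      then show ?thesis using AT(1)[OF True] ij True by (simp add: P'_def)
    qed
  next
    case False
    then have j: "j < r" using ij by linarith
    show ?thesis using AT(2)[OF j] False j ij by (simp add: P'_def)
  qed
  moreover have "finite (P' i) \<and> card (P' i) = t" for i
    using A T' by (simp add: P'_def)
  ultimately have "multipartite E (Suc r) t P'" unfolding multipartite_def by simp
  moreover have "P' i \<subseteq> D" for i
  proof (cases "i < r")
    case True
    then show ?thesis using A[OF True] P(2)[OF True] by (auto simp: P'_def)
  next
    case False
    then show ?thesis using T'(1) U(1) by (auto simp: P'_def T_def)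
  qed
  ultimately show ?thesis by blast
qed

text \<open>Here \<open>q\<close> bounds the number of non-neighbours, so the last premise asks for
  relative minimum degree above \<open>1 - 1/(r-1)\<close> with margin \<open>c\<close>. The
  induction on \<open>r\<close> runs over all \<open>t\<close>, because adding a part shrinks the
  old ones from size \<open>s\<close> to \<open>t\<close>.\<close>

lemma exists_multipartite:
  fixes c :: real
  assumes "0 < c"
  shows "\<exists>N. \<forall>(D :: 'v set) E (q :: real). finite D \<longrightarrow> N \<le> card D \<longrightarrow>
    (\<forall>u\<in>D. card (D - nbhd E u) \<le> q) \<longrightarrow> (real r - 1) * q \<le> (1 - c) * card D \<longrightarrow>
    (\<exists>P. multipartite E r t P \<and> (\<forall>i<r. P i \<subseteq> D))"
proof (induction r arbitrary: t)
  case 0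
  show ?case by (simp add: multipartite_def)
next
  case (Suc r)
  \<comment> \<open>Chosen to give \<open>t < s\<close> and \<open>2 * t \<le> c * s\<close>, as
    \<open>multipartite_extend\<close> requires.\<close>
  define s where "s = t + 1 + nat \<lceil>2 * t / c\<rceil>"
  have "2 * t / c \<le> s" unfolding s_def by linarith
  then have s: "t < s" "2 * t \<le> c * s" using assms by (auto simp: s_def field_simps)
  obtain N1 where N1: "\<And>(D :: 'v set) E (q :: real). finite D \<Longrightarrow> N1 \<le> card D \<Longrightarrow>
    \<forall>u\<in>D. card (D - nbhd E u) \<le> q \<Longrightarrow> (real r - 1) * q \<le> (1 - c) * card D \<Longrightarrow>
    \<exists>P. multipartite E r s P \<and> (\<forall>i<r. P i \<subseteq> D)"
    using Suc.IH[of s] by meson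
  define K where "K = (t + 1) * 2 ^ (r * s)"
  define N where "N = N1 + 1 + nat \<lceil>2 * K / c\<rceil>"
  have "\<exists>P. multipartite E (Suc r) t P \<and> (\<forall>i<Suc r. P i \<subseteq> D)"
    if D: "finite D" "N \<le> card D" "\<forall>u\<in>D. card (D - nbhd E u) \<le> q"
      "(real (Suc r) - 1) * q \<le> (1 - c) * card D" for D :: "'v set" and E and q :: real
  proof -
    have "D \<noteq> {}" using D(2) by (auto simp: N_def)
    then obtain u0 where "u0 \<in> D" by blast
    then have "0 \<le> q" using D(3) of_nat_0_le_iff order_trans by blast
    \<comment> \<open>Since \<open>q\<close> is nonnegative, the density condition for
      \<open>r + 1\<close> parts implies the one for \<open>r\<close> parts.\<close>
    then have "(real r - 1) * q \<le> (1 - c) * card D" using D(4) by (simp add: algebra_simps)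
    then obtain P where P: "multipartite E r s P" "\<forall>i<r. P i \<subseteq> D"
      using N1[OF D(1) _ D(3)] D(2) by (auto simp: N_def)
    have "2 * K / c < card D" using D(2) unfolding N_def by linarith
    then have "K < c / 2 * card D" using assms by (simp add: field_simps)
    then show ?thesis using P D(3,4) s assms
      by (intro multipartite_extend[OF D(1), where s = s and P = P and q = q and c = c]) (simp_all add: K_def algebra_simps)
  qed
  then show ?case by meson
qed

text \<open>The cone over the Turan graph \<open>T\<^sub>n\<^sub>-\<^sub>1\<^sub>,\<^sub>r\<close> has about \<open>n / r\<close> more edges than \<open>T\<^sub>n\<^sub>,\<^sub>r\<close>, too many to be \<open>F\<close>-free.\<close>

lemma contained_in_turan_cone:
  fixes C :: real
  assumes "r \<ge> 2" and near: "\<And>n. \<bar>real (ex n VF EF) - card (turan_edges n r)\<bar> \<le> C"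
  shows "\<exists>n. contains VF EF {..<n} (turan_edges n r \<union> {{0, v} | v. 0 < v \<and> v < n})"
proof -
  \<comment> \<open>With \<open>n = m * r + 1\<close> the class of \<open>0\<close> also contains
    \<open>r, 2r, ..., mr\<close>, so joining \<open>0\<close> to everything adds
    \<open>m > C\<close> edges to the Turan graph.\<close>
  define m where "m = nat \<lceil>C\<rceil> + 1"
  define n where "n = m * r + 1"
  define K where "K = turan_edges n r \<union> {{0, v} | v. 0 < v \<and> v < n}"
  have r: "r > 0" using assms(1) by simp
  have g: "graph {..<n} K"
    unfolding graph_def
  proof (intro conjI ballI)
    fix e assume "e \<in> K"
    then consider u v where "e = {u, v}" "u < n" "v < n" "u mod r \<noteq> v mod r"
      | v where "e = {0, v}" "0 < v" "v < n"
      unfolding K_def turan_edges_def by blast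
    then show "\<exists>u v. u \<in> {..<n} \<and> v \<in> {..<n} \<and> u \<noteq> v \<and> e = {u, v}"
    proof cases
      case 1
      then show ?thesis by (intro exI[of _ u] exI[of _ v]) auto
    next
      case 2
      then show ?thesis by (intro exI[of _ 0] exI[of _ v]) auto
    qed
  qed simp
  let ?A = "(\<lambda>j. {0, Suc j * r}) ` {..<m}"
  have "card ?A = m"
    using r by (subst card_image) (auto simp: inj_on_def doubleton_eq_iff)
  moreover have "turan_edges n r \<inter> ?A = {}"
    by (auto simp: turan_edges_def doubleton_eq_iff)
  ultimately have "card (turan_edges n r \<union> ?A) = card (turan_edges n r) + m"
    using finite_turan_edges[of n r] by (subst card_Un_disjoint) auto
  moreover have "?A \<subseteq> K"
  proof
    fix e assume "e \<in> ?A"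
    then obtain j where j: "j < m" "e = {0, Suc j * r}" by auto
    have "Suc j * r \<le> m * r" using j(1) by (intro mult_le_mono1) simp
    then have "0 < Suc j * r" "Suc j * r < n" using r by (auto simp: n_def)
    then show "e \<in> K" using j(2) unfolding K_def by blast
  qed
  then have "turan_edges n r \<union> ?A \<subseteq> K" by (auto simp: K_def)
  ultimately have "card (turan_edges n r) + m \<le> card K"
    using card_mono[OF graph_finite_edges[OF g]] by metis
  moreover have "C < m" unfolding m_def by linarith
  ultimately have "ex n VF EF < card K" using near[of n] by linarith
  then have "contains VF EF {..<n} K" using card_le_ex[OF g] by (meson not_le)
  then show ?thesis unfolding K_def by blast
qed

text \<open>A copy of \<open>F\<close> in the Turan cone is transferred: the apex \<open>0\<close>
  goes to \<open>v\<close>, residue class \<open>i\<close> goes into \<open>P i\<close>. Parts of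
  size \<open>card VF\<close> suffice, as each \<open>b i\<close> is injective on all of
  \<open>VF\<close>.\<close>

lemma contains_cone_over_multipartite:
  fixes C :: real
  assumes "r \<ge> 2" "graph VF EF"
    and near: "\<And>n. \<bar>real (ex n VF EF) - card (turan_edges n r)\<bar> \<le> C"
    and "graph V E" "multipartite E r (card VF) P" "\<And>i. i < r \<Longrightarrow> P i \<subseteq> nbhd E v"
  shows "contains VF EF (insert v (\<Union>i<r. P i)) E"
proof -
  obtain n where "contains VF EF {..<n} (turan_edges n r \<union> {{0, v} | v. 0 < v \<and> v < n})"
    using contained_in_turan_cone[OF assms(1) near] by blast
  then obtain f where f: "inj_on f VF" "f ` VF \<subseteq> {..<n}"
    "\<forall>e\<in>EF. f ` e \<in> turan_edges n r \<union> {{0, v} | v. 0 < v \<and> v < n}"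
    by (rule containsE)
  have finP: "finite (P i)" "card (P i) = card VF" if "i < r" for i
    using assms(5) that by (auto simp: multipartite_def)
  have "\<exists>b. bij_betw b VF (P i)" if "i < r" for i
    using finP[OF that] graph_finite[OF assms(2)] by (intro finite_same_card_bij) auto
  then obtain b where b: "\<And>i. i < r \<Longrightarrow> bij_betw (b i) VF (P i)" by metis
  define g where "g x = (if f x = 0 then v else b (f x mod r) x)" for x
  have r: "f x mod r < r" for x using assms(1) by simp
  have bP: "b (f x mod r) x \<in> P (f x mod r)" if "x \<in> VF" for x
    using b[OF r[of x]] that by (auto simp: bij_betw_def)
  have v: "{v, b (f x mod r) x} \<in> E" "v \<noteq> b (f x mod r) x" if "x \<in> VF" for x
  proof -
    show "{v, b (f x mod r) x} \<in> E" using assms(6)[OF r[of x]] bP[OF that] by (auto simp: nbhd_def)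
    from graph_edgeD(3)[OF assms(4) this] show "v \<noteq> b (f x mod r) x" .
  qed
  have cross: "{b (f x mod r) x, b (f y mod r) y} \<in> E"
    if "x \<in> VF" "y \<in> VF" "f x mod r \<noteq> f y mod r" for x y
    by (rule multipartite_edge[OF assms(5) r r that(3) bP[OF that(1)] bP[OF that(2)]])
  have "inj_on g VF"
  proof (rule inj_onI)
    fix x y assume xy: "x \<in> VF" "y \<in> VF" "g x = g y"
    \<comment> \<open>Images in different parts, or in a part and at \<open>v\<close>, are adjacent
      and therefore distinct.\<close>
    consider "f x = 0" "f y = 0" | "f x = 0" "f y \<noteq> 0" | "f x \<noteq> 0" "f y = 0"
      | "f x \<noteq> 0" "f y \<noteq> 0" "f x mod r \<noteq> f y mod r" | "f x \<noteq> 0" "f y \<noteq> 0" "f x mod r = f y mod r"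
      by blast
    then show "x = y"
    proof cases
      case 1
      then show ?thesis using inj_onD[OF f(1), of x y] xy by simp
    next
      case 2
      then show ?thesis using v(2)[OF xy(2)] xy(3) by (simp add: g_def)
    next
      case 3
      then show ?thesis using v(2)[OF xy(1)] xy(3) by (simp add: g_def)
    next
      case 4
      then show ?thesis using graph_edgeD(3)[OF assms(4) cross[OF xy(1,2)]] xy(3) by (simp add: g_def)
    next
      case 5
      then show ?thesis
        using inj_onD[OF bij_betw_imp_inj_on[OF b[OF r[of y]]], of x y] xy by (simp add: g_def)
    qed
  qed
  moreover have "g x \<in> insert v (\<Union>i<r. P i)" if "x \<in> VF" for x
    using bP[OF that] r[of x] by (auto simp: g_def)
  moreover have "g ` e \<in> E" if e: "e \<in> EF" for e
  proof -
    obtain x y where xy: "x \<in> VF" "y \<in> VF" "x \<noteq> y" "e = {x, y}"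
      using assms(2) e by (auto simp: graph_def)
    have ne: "f x \<noteq> f y" using inj_onD[OF f(1), of x y] xy by auto
    have "{f x, f y} \<in> turan_edges n r \<union> {{0, v} | v. 0 < v \<and> v < n}"
      using bspec[OF f(3) e] xy(4) by simp
    then have "f x mod r \<noteq> f y mod r \<or> f x = 0 \<or> f y = 0"
      by (auto simp: turan_edges_def doubleton_eq_iff)
    then consider "f x = 0" "f y \<noteq> 0" | "f x \<noteq> 0" "f y = 0"
      | "f x \<noteq> 0" "f y \<noteq> 0" "f x mod r \<noteq> f y mod r"
      using ne by metis
    then show ?thesis
    proof cases
      case 1
      then show ?thesis using v(1)[OF xy(2)] xy(4) by (simp add: g_def insert_commute)
    next
      case 2
      then show ?thesis using v(1)[OF xy(1)] xy(4) by (simp add: g_def insert_commute)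
    next
      case 3
      then show ?thesis using cross[OF xy(1,2)] xy(4) by (simp add: g_def)
    qed
  qed
  ultimately show ?thesis by (intro containsI[of g]) auto
qed

section \<open>Degrees in nearly extremal graphs\<close>

lemma card_edges_le_of_induced_free:
  fixes C :: real
  assumes near: "\<And>n. \<bar>real (ex n VF EF) - card (turan_edges n r)\<bar> \<le> C"
    and "graph V E" "W \<subseteq> V" "\<not> contains VF EF (V - W) E"
  shows "real (card E) \<le> card (turan_edges (card (V - W)) r) + C + (\<Sum>w\<in>W. real (card (nbhd E w)))"
proof -
  have "card (induced (V - W) E) \<le> ex (card (V - W)) VF EF"
    using assms by (intro card_induced_le_ex[of V]) auto
  then have "real (card (induced (V - W) E)) \<le> ex (card (V - W)) VF EF"
    by (rule of_nat_mono)
  moreover have "real (card E) \<le> card (induced (V - W) E) + (\<Sum>w\<in>W. real (card (nbhd E w)))"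
    using card_edges_le_induced_plus_degrees[OF assms(2,3)] by (simp flip: of_nat_sum of_nat_add)
  ultimately show ?thesis using near[of "card (V - W)"] by linarith
qed

text \<open>Crude: each of the at most \<open>k * card VF\<close> vertices of a hitting set is
  charged up to \<open>card V\<close> edges.\<close>

lemma card_edges_le_of_copies_free:
  fixes C :: real
  assumes near: "\<And>n. \<bar>real (ex n VF EF) - card (turan_edges n r)\<bar> \<le> C"
    and "finite VF" "graph V E" "\<not> contains (copiesV k VF) (copiesE k EF) V E"
  shows "real (card E) \<le> card (turan_edges (card V) r) + C + real (k * card VF) * card V"
proof -
  obtain W where W: "W \<subseteq> V" "card W \<le> k * card VF" "\<not> contains VF EF (V - W) E"
    using exists_hitting_set[OF assms(2) graph_finite[OF assms(3)] assms(4)] by blast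
  have "(\<Sum>w\<in>W. real (card (nbhd E w))) \<le> (\<Sum>w\<in>W. real (card V))"
    using card_nbhd_le[OF assms(3)] by (intro sum_mono) simp
  also have "\<dots> \<le> real (k * card VF) * card V"
    using W(2) by (simp del: of_nat_mult add: mult_right_mono)
  finally have "(\<Sum>w\<in>W. real (card (nbhd E w))) \<le> real (k * card VF) * card V" .
  moreover have "card (turan_edges (card (V - W)) r) \<le> card (turan_edges (card V) r)"
    using graph_finite[OF assms(3)] by (intro card_turan_edges_mono card_mono) auto
  ultimately show ?thesis
    using card_edges_le_of_induced_free[OF near assms(3) W(1,3)] by linarith
qed

text \<open>Deleting \<open>K\<close> such vertices saves \<open>K * \<epsilon> * n\<close> edges
  against the Turan count, while the \<open>kF\<close>-free rest exceeds its own Turan count by at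
  most \<open>k * card VF * n + C\<close>. The condition on \<open>K\<close> makes the saving larger
  by \<open>n\<close>.\<close>

lemma few_low_degree_vertices:
  fixes C C1 \<epsilon> :: real
  assumes "r > 0" and near: "\<And>n. \<bar>real (ex n VF EF) - card (turan_edges n r)\<bar> \<le> C"
    and "finite VF" and G: "graph V E" "\<not> contains (copiesV k VF) (copiesE k EF) V E"
    and edges: "card (turan_edges (card V) r) - C1 \<le> card E"
    and K: "k * card VF + 1 \<le> K * \<epsilon>" and large: "K * K + C + C1 < card V"
  shows "card {v \<in> V. card (nbhd E v) < (1 - 1 / r - \<epsilon>) * card V} < K"
proof (rule ccontr)
  assume "\<not> ?thesis"
  then obtain Z where Z: "Z \<subseteq> {v \<in> V. card (nbhd E v) < (1 - 1 / r - \<epsilon>) * card V}" "card Z = K" "finite Z"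
    using obtain_subset_with_card_n[of K] by (metis not_less)
  define n where "n = card V"
  define m where "m = card (V - Z)"
  have ZV: "Z \<subseteq> V" using Z(1) by blast
  have n: "n = m + K"
    using card_Diff_subset[OF Z(3) ZV] card_mono[OF graph_finite[OF G(1)] ZV] Z(2) by (simp add: n_def m_def)
  have gZ: "graph (V - Z) (induced (V - Z) E)" using G(1) by (intro graph_induced) auto
  have "\<not> contains (copiesV k VF) (copiesE k EF) (V - Z) (induced (V - Z) E)"
    using G(2) contains_mono[of _ _ "V - Z" "induced (V - Z) E" V E] by (auto simp: induced_def)
  from card_edges_le_of_copies_free[OF near assms(3) gZ this]
  have 1: "real (card (induced (V - Z) E)) \<le> card (turan_edges m r) + C + real (k * card VF) * m"
    by (simp add: m_def)
  have "(\<Sum>z\<in>Z. real (card (nbhd E z))) \<le> (\<Sum>z\<in>Z. (1 - 1 / r - \<epsilon>) * n)"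
    using Z(1) by (intro sum_mono) (auto simp: n_def)
  then have 2: "(\<Sum>z\<in>Z. real (card (nbhd E z))) \<le> K * ((1 - 1 / r - \<epsilon>) * n)"
    using Z(2) by simp
  have 3: "real (card E) \<le> card (induced (V - Z) E) + (\<Sum>z\<in>Z. real (card (nbhd E z)))"
    using card_edges_le_induced_plus_degrees[OF G(1) ZV] by (simp flip: of_nat_sum of_nat_add)
  have 4: "real (card (turan_edges m r)) + real K * ((1 - 1 / real r) * real m) \<le> card (turan_edges n r)"
    using card_turan_edges_add(1)[OF assms(1), of m K] by (simp add: n)
  have 5: "real (k * card VF) * m \<le> real (k * card VF) * n"
    by (intro mult_left_mono) (simp_all add: n)
  have 6: "(real (k * card VF) + 1) * n \<le> (K * \<epsilon>) * n"
    using K by (intro mult_right_mono) auto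
  have 7: "real K * ((1 - 1 / r) * (real n - m)) \<le> real K * K"
    using assms(1) n by (intro mult_left_mono) (simp_all add: mult_left_le_one_le)
  \<comment> \<open>Passing from \<open>n\<close> to \<open>m\<close> matches the Turan increment in
    fact 4, at the price of an error of at most \<open>K * K\<close>.\<close>
  have "real K * ((1 - 1 / r - \<epsilon>) * n) = real K * ((1 - 1 / r) * m) + real K * ((1 - 1 / r) * (real n - m)) - (K * \<epsilon>) * n"
    by (simp add: algebra_simps)
  moreover have "(real (k * card VF) + 1) * n = real (k * card VF) * n + n" by (simp add: algebra_simps)
  moreover have "card (turan_edges n r) - C1 \<le> card E" "K * K + C + C1 < n"
    using edges large by (simp_all add: n_def)
  ultimately show False using 1 2 3 4 5 6 7 by simp
qed

text \<open>A vertex exceeds the Turan degree by at most \<open>n / r\<close>, and one outside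
  \<open>L\<close> by at most \<open>\<eta> * n\<close>. If \<open>L\<close> had at most
  \<open>k - 2\<close> vertices, then \<open>L\<close> and a hitting set \<open>W\<close> could not
  account for the surplus \<open>(k - 1) * n / r\<close>: the vertices of \<open>W - L\<close> add
  at most \<open>n / (4 * r)\<close>.\<close>

lemma many_high_degree_vertices:
  fixes C C1 \<eta> :: real
  assumes "r > 0" and near: "\<And>n. \<bar>real (ex n VF EF) - card (turan_edges n r)\<bar> \<le> C"
    and "finite VF" and G: "graph V E" "\<not> contains (copiesV k VF) (copiesE k EF) V E"
    and edges: "card (turan_edges (card V) r) + (real k - 1) * card V / r - C1 \<le> card E"
    and \<eta>: "k * card VF * \<eta> \<le> 1 / (4 * r)" "0 < \<eta>"
    and large: "2 * r * ((real (k * card VF) + k)\<^sup>2 + C + C1) < card V"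
  shows "k - 1 \<le> card {v \<in> V. (1 - 1 / r + \<eta>) * card V \<le> card (nbhd E v)}"
proof (rule ccontr)
  define L where "L = {v \<in> V. (1 - 1 / r + \<eta>) * card V \<le> card (nbhd E v)}"
  assume "\<not> ?thesis"
  then have L: "card L + 2 \<le> k" by (simp add: L_def)
  define n where "n = card V"
  have LV: "L \<subseteq> V" "finite L" using graph_finite[OF G(1)] by (auto simp: L_def)
  obtain W where W: "W \<subseteq> V" "card W \<le> k * card VF" "\<not> contains VF EF (V - W) E"
    using exists_hitting_set[OF assms(3) graph_finite[OF G(1)] G(2)] by blast
  have finW: "finite W" using W(1) graph_finite[OF G(1)] by (metis finite_subset)
  define w where "w = card (W - L)"
  define m where "m = card (V - (W \<union> L))"
  have WL: "card (W \<union> L) = w + card L"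
    using finW LV(2) card_Un_disjoint[of "W - L" L] by (simp add: w_def Diff_disjoint Int_commute)
  have w: "w \<le> k * card VF"
    using W(2) card_mono[OF finW, of "W - L"] by (auto simp: w_def)
  then have wr: "real w \<le> real (k * card VF)" by (rule of_nat_mono)
  have n: "n = m + (w + card L)"
    using card_Diff_subset[of "W \<union> L" V] card_mono[OF graph_finite[OF G(1)], of "W \<union> L"] finW LV W(1) WL
    by (simp add: n_def m_def)
  have "\<not> contains VF EF (V - (W \<union> L)) E"
    using W(3) contains_mono[of VF EF "V - (W \<union> L)" E "V - W" E] by auto
  from card_edges_le_of_induced_free[OF near G(1) _ this]
  have 1: "real (card E) \<le> card (turan_edges m r) + C + (\<Sum>v\<in>W \<union> L. real (card (nbhd E v)))"
    using W(1) LV(1) by (simp add: m_def)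
  have "(\<Sum>v\<in>W \<union> L. real (card (nbhd E v)))
      = (\<Sum>v\<in>W - L. real (card (nbhd E v))) + (\<Sum>v\<in>L. real (card (nbhd E v)))"
    using finW LV(2) sum.union_disjoint[of "W - L" L "\<lambda>v. real (card (nbhd E v))"]
    by (simp add: Int_commute)
  moreover have "(\<Sum>v\<in>W - L. real (card (nbhd E v))) \<le> (\<Sum>v\<in>W - L. (1 - 1 / r + \<eta>) * n)"
    using W(1) by (intro sum_mono) (auto simp: L_def n_def)
  moreover have "(\<Sum>v\<in>L. real (card (nbhd E v))) \<le> (\<Sum>v\<in>L. real n)"
    using card_nbhd_le[OF G(1)] by (intro sum_mono) (simp add: n_def)
  ultimately have 2: "(\<Sum>v\<in>W \<union> L. real (card (nbhd E v))) \<le> w * ((1 - 1 / r + \<eta>) * n) + card L * real n"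
    by (simp add: w_def)
  define d where "d = real w + card L"
  have 4: "real (card (turan_edges m r)) + d * ((1 - 1 / real r) * real m) \<le> card (turan_edges n r)"
    using card_turan_edges_add(1)[OF assms(1), of m "w + card L"] by (simp add: n d_def)
  have "d * ((1 - 1 / r) * (real n - m)) \<le> d * d"
    using assms(1) n by (intro mult_left_mono) (simp_all add: mult_left_le_one_le d_def)
  also have "d * d \<le> (real (k * card VF) + k)\<^sup>2"
  proof -
    have "d \<le> real (k * card VF) + k" unfolding d_def
      using wr L by linarith
    then show ?thesis unfolding power2_eq_square by (intro mult_mono) (simp_all add: d_def)
  qed
  finally have 5: "d * ((1 - 1 / r) * (real n - m)) \<le> (real (k * card VF) + k)\<^sup>2" .
  have "w * \<eta> \<le> real (k * card VF) * \<eta>"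
    using wr \<eta>(2) by (intro mult_right_mono) simp_all
  then have "w * \<eta> \<le> 1 / (4 * r)" using \<eta>(1) by simp
  then have 6: "w * \<eta> * n \<le> 1 / (4 * r) * n"
    by (rule mult_right_mono) simp
  have 7: "card L * (n / r) \<le> (real k - 2) * (n / r)"
    using L by (intro mult_right_mono) auto
  have 8: "card (turan_edges n r) + (real k - 1) * n / r - C1 \<le> card E"
    "2 * r * ((real (k * card VF) + k)\<^sup>2 + C + C1) < n"
    using edges large by (simp_all add: n_def)
  \<comment> \<open>The bound on edges at \<open>W\<close> and \<open>L\<close>, split into Turan
    growth, a bounded error, the excess \<open>\<eta> * n\<close> per vertex of
    \<open>W - L\<close>, and \<open>n / r\<close> per vertex of \<open>L\<close>.\<close>
  have "w * ((1 - 1 / r + \<eta>) * n) + card L * real n =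
     d * ((1 - 1 / r) * m) + d * ((1 - 1 / r) * (real n - m)) + w * \<eta> * n + card L * (n / r)"
    unfolding d_def using assms(1) by (simp add: algebra_simps)
  then have "card (turan_edges n r) + (real k - 1) * n / r - C1 \<le>
     card (turan_edges n r) + C + (real (k * card VF) + k)\<^sup>2 + 1 / (4 * r) * n + (real k - 2) * (n / r)"
    using 1 2 4 5 6 7 8(1) by linarith
  then have "n / r \<le> C + C1 + (real (k * card VF) + k)\<^sup>2 + 1 / (4 * r) * n"
    by (simp add: algebra_simps diff_divide_distrib)
  then have "3 * n \<le> 4 * r * ((real (k * card VF) + k)\<^sup>2 + C + C1)"
    using assms(1) by (simp add: field_simps)
  then show False using 8(2) by simp
qed

text \<open>Erdos-Stone is applied to the neighbourhood of \<open>v\<close> without \<open>X\<close>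
  and the low-degree vertices. The threshold \<open>N\<close> is a premise because it must be fixed
  before the graph.\<close>

lemma contains_avoiding_of_high_degree:
  fixes C \<eta> :: real and V :: "'v set"
  assumes "r \<ge> 2" "graph VF EF"
    and near: "\<And>n. \<bar>real (ex n VF EF) - card (turan_edges n r)\<bar> \<le> C"
    and G: "graph V E" and "0 < \<eta>"
    and low: "card {v \<in> V. card (nbhd E v) < (1 - 1 / r - \<eta> / (2 * r)) * card V} \<le> K"
    and N: "\<forall>(D :: 'v set) E (q :: real). finite D \<longrightarrow> N \<le> card D \<longrightarrow>
      (\<forall>u\<in>D. card (D - nbhd E u) \<le> q) \<longrightarrow> (real r - 1) * q \<le> (1 - \<eta> / 4) * card D \<longrightarrow>
      (\<exists>P. multipartite E r (card VF) P \<and> (\<forall>i<r. P i \<subseteq> D))"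
    and large: "4 * (real M + K) \<le> \<eta> * card V" "2 * N \<le> card V"
    and v: "v \<in> V" "(1 - 1 / r + \<eta>) * card V \<le> card (nbhd E v)"
    and X: "finite X" "v \<notin> X" "card X \<le> M"
  shows "contains VF EF (V - X) E"
proof -
  define n where "n = card V"
  define Z where "Z = {v \<in> V. card (nbhd E v) < (1 - 1 / r - \<eta> / (2 * r)) * n}"
  define D where "D = nbhd E v - (X \<union> Z)"
  define q where "q = (1 / r + \<eta> / (2 * r)) * n"
  have finV: "finite V" using G by (rule graph_finite)
  have finZ: "finite Z" "card Z \<le> K" using finV low by (auto simp: Z_def n_def)
  have finD: "finite D" using finite_nbhd[OF G] by (auto simp: D_def)
  have "card (X \<union> Z) \<le> M + K" using card_Un_le[of X Z] finZ(2) X(3) by linarith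
  moreover have "card (nbhd E v) \<le> card D + card (X \<union> Z)"
    using finD X(1) finZ(1) card_Un_le[of D "X \<union> Z"] card_mono[of "D \<union> (X \<union> Z)" "nbhd E v"]
    by (auto simp: D_def)
  ultimately have "card (nbhd E v) \<le> card D + (M + K)" by linarith
  then have "real (card (nbhd E v)) \<le> real (card D + (M + K))" by (rule of_nat_mono)
  then have "(1 - 1 / r + \<eta>) * n - (real M + K) \<le> card D"
    using v(2) by (simp add: n_def)
  \<comment> \<open>At most \<open>M + K\<close> vertices were removed, which costs at most a
    quarter of \<open>\<eta> * n\<close>.\<close>
  then have cardD: "(1 - 1 / r) * n + 3 / 4 * (\<eta> * n) \<le> card D"
    using large(1) by (simp add: n_def distrib_right)
  have half: "1 / real r \<le> 1 / 2" using assms(1) by (simp add: field_simps)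
  have "1 / 2 * n \<le> (1 - 1 / r) * n" using half by (intro mult_right_mono) auto
  moreover have "0 \<le> \<eta> * n" using assms(5) by simp
  ultimately have "N \<le> card D" using cardD large(2) by (simp add: n_def)
  moreover have "card (D - nbhd E u) \<le> q" if u: "u \<in> D" for u
  proof -
    have "u \<in> V" "u \<notin> Z" using u nbhd_subset[OF G] by (auto simp: D_def)
    then have deg: "(1 - 1 / r - \<eta> / (2 * r)) * n \<le> card (nbhd E u)" by (simp add: Z_def not_less)
    have "card (D - nbhd E u) \<le> card (V - nbhd E u)"
      using finV nbhd_subset[OF G] by (intro card_mono) (auto simp: D_def)
    also have "\<dots> = n - card (nbhd E u)"
      using card_Diff_subset[OF finite_nbhd[OF G] nbhd_subset[OF G]] by (simp add: n_def)
    finally have "real (card (D - nbhd E u)) \<le> real (n - card (nbhd E u))" by (rule of_nat_mono)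
    also have "\<dots> = real n - card (nbhd E u)"
      using card_nbhd_le[OF G] by (simp add: n_def of_nat_diff)
    also have "\<dots> \<le> q" using deg by (simp add: q_def algebra_simps)
    finally show ?thesis .
  qed
  moreover have "(real r - 1) * q \<le> (1 - \<eta> / 4) * card D"
  proof -
    \<comment> \<open>This leaves \<open>(r - 1) * q\<close> at least \<open>\<eta> / 4 * n\<close>
      below the bound \<open>cardD\<close>, which pays for the margin
      \<open>\<eta> / 4 * card D\<close>.\<close>
    have "(real r - 1) * (1 / r + \<eta> / (2 * r)) \<le> 1 - 1 / r + \<eta> / 2"
      using assms(1,5) by (simp add: field_simps)
    then have "(real r - 1) * q \<le> (1 - 1 / r + \<eta> / 2) * n"
      unfolding q_def mult.assoc [symmetric] by (rule mult_right_mono) simp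
    moreover have "D \<subseteq> V" using nbhd_subset[OF G] by (auto simp: D_def)
    then have "\<eta> / 4 * card D \<le> \<eta> / 4 * n"
      using assms(5) card_mono[OF finV] by (intro mult_left_mono) (auto simp: n_def)
    ultimately show ?thesis using cardD by (simp add: algebra_simps)
  qed
  ultimately obtain P where P: "multipartite E r (card VF) P" "\<forall>i<r. P i \<subseteq> D"
    using N finD by blast
  have "contains VF EF (insert v (\<Union>i<r. P i)) E"
    using P by (intro contains_cone_over_multipartite[OF assms(1-3) G P(1)]) (auto simp: D_def)
  moreover have "insert v (\<Union>i<r. P i) \<subseteq> V - X"
    using P(2) v(1) X(2) nbhd_subset[OF G] by (force simp: D_def)
  ultimately show ?thesis by (rule contains_mono) simp
qed

text \<open>Every copy of \<open>F\<close> meets \<open>S\<close>, and disjoint copies meet it in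
  different vertices.\<close>

lemma not_contains_copies_of_small_cover:
  assumes "\<not> contains VF EF (V - S) E" "finite S" "card S < k"
  shows "\<not> contains (copiesV k VF) (copiesE k EF) V E"
proof
  assume "contains (copiesV k VF) (copiesE k EF) V E"
  then obtain g where g: "\<forall>i<k. inj_on (g i) VF \<and> g i ` VF \<subseteq> V \<and> (\<forall>e\<in>EF. g i ` e \<in> E)"
    and disj: "\<forall>i<k. \<forall>j<k. i \<noteq> j \<longrightarrow> g i ` VF \<inter> g j ` VF = {}"
    unfolding contains_copies_iff by (elim exE conjE)
  have "\<exists>s. s \<in> S \<and> s \<in> g i ` VF" if i: "i < k" for i
  proof (rule ccontr)
    assume "\<not> ?thesis"
    then have "g i ` VF \<subseteq> V - S" using g i by blast
    then have "contains VF EF (V - S) E" using g i by (intro containsI[of "g i"]) auto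
    then show False using assms(1) by simp
  qed
  then obtain s where s: "\<And>i. i < k \<Longrightarrow> s i \<in> S" "\<And>i. i < k \<Longrightarrow> s i \<in> g i ` VF" by metis
  have "inj_on s {..<k}"
  proof (rule inj_onI, rule ccontr)
    fix i j assume *: "i \<in> {..<k}" "j \<in> {..<k}" "s i = s j" "i \<noteq> j"
    then have "g i ` VF \<inter> g j ` VF = {}" using disj by simp
    moreover have "s i \<in> g i ` VF" "s i \<in> g j ` VF" using s(2)[of i] s(2)[of j] * by simp_all
    ultimately show False by (metis IntI empty_iff)
  qed
  then have "card {..<k} \<le> card S" using s(1) assms(2) by (intro card_inj_on_le[of s]) auto
  then show False using assms(3) by simp
qed

section \<open>The extremal structure\<close>

text \<open>For \<open>S\<close> inside \<open>{..<n}\<close>: the edges of a join that meet its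
  complete part \<open>S\<close>, both within \<open>S\<close> and from \<open>S\<close> to the
  rest.\<close>

definition star_edges :: "nat \<Rightarrow> nat set \<Rightarrow> nat set set" where
  "star_edges n S = {{u, v} | u v. u \<in> S \<and> v \<in> {..<n} \<and> u \<noteq> v}"

lemma star_edges_eq:
  assumes "S \<subseteq> {..<n}"
  shows "star_edges n S = {e. e \<subseteq> {..<n} \<and> card e = 2} - {e. e \<subseteq> {..<n} - S \<and> card e = 2}"
proof (intro equalityI subsetI)
  fix e assume "e \<in> star_edges n S"
  then show "e \<in> {e. e \<subseteq> {..<n} \<and> card e = 2} - {e. e \<subseteq> {..<n} - S \<and> card e = 2}"
    using assms by (auto simp: star_edges_def)
next
  fix e assume e: "e \<in> {e. e \<subseteq> {..<n} \<and> card e = 2} - {e. e \<subseteq> {..<n} - S \<and> card e = 2}"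
  then obtain u v where uv: "e = {u, v}" "u \<noteq> v" by (auto simp: card_2_iff)
  then consider "u \<in> S" "v < n" | "v \<in> S" "u < n" using e by auto
  then show "e \<in> star_edges n S"
  proof cases
    case 1
    then show ?thesis using uv by (auto simp: star_edges_def)
  next
    case 2
    moreover have "e = {v, u}" using uv(1) by (simp add: insert_commute)
    ultimately show ?thesis using uv(2) by (auto simp: star_edges_def)
  qed
qed

lemma finite_star_edges: "S \<subseteq> {..<n} \<Longrightarrow> finite (star_edges n S)"
  by (rule finite_subset[of _ "Pow {..<n}"]) (auto simp: star_edges_def)

text \<open>The count depends on \<open>S\<close> only through its size, so stars at different sets
  of \<open>k - 1\<close> vertices can be exchanged.\<close>

lemma card_star_edges:
  assumes "S \<subseteq> {..<n}"
  shows "card (star_edges n S) = (n choose 2) - ((n - card S) choose 2)"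
proof -
  have "finite S" using assms by (rule finite_subset) simp
  then have "card ({..<n} - S) = n - card S" using assms by (simp add: card_Diff_subset)
  then show ?thesis
    unfolding star_edges_eq[OF assms] using n_subsets[of "{..<n}" 2] n_subsets[of "{..<n} - S" 2]
    by (subst card_Diff_subset) (auto intro: finite_subset[of _ "Pow {..<n}"])
qed

lemma card_star_edges_ge:
  assumes "S \<subseteq> {..<n}"
  shows "card S * (n - card S) \<le> card (star_edges n S)"
proof -
  have finS: "finite S" using assms by (rule finite_subset) simp
  have "inj_on (\<lambda>(u, v). {u, v}) (S \<times> ({..<n} - S))"
    by (auto simp: inj_on_def doubleton_eq_iff)
  then have "card (S \<times> ({..<n} - S)) \<le> card (star_edges n S)"
  proof (rule card_inj_on_le)
    show "(\<lambda>(u, v). {u, v}) ` (S \<times> ({..<n} - S)) \<subseteq> star_edges n S"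
    proof
      fix e assume "e \<in> (\<lambda>(u, v). {u, v}) ` (S \<times> ({..<n} - S))"
      then obtain u v where "e = {u, v}" "u \<in> S" "v \<in> {..<n}" "v \<notin> S" by auto
      then show "e \<in> star_edges n S"
        unfolding star_edges_def by (intro CollectI exI[of _ u] exI[of _ v]) auto
    qed
    show "finite (star_edges n S)" using assms by (rule finite_star_edges)
  qed
  then show ?thesis using assms finS by (simp add: card_cartesian_product card_Diff_subset)
qed

text \<open>The join of \<open>K_{k-1}\<close> with an extremal \<open>F\<close>-free graph is
  \<open>kF\<close>-free, since its complete part meets every copy of \<open>F\<close>.\<close>

lemma ex_copies_ge:
  assumes "graph VF EF" "EF \<noteq> {}" "S \<subseteq> {..<n}" "card S = k - 1" "1 \<le> k" "k \<le> n"
  shows "ex (n - k + 1) VF EF + card (star_edges n S) \<le> ex n (copiesV k VF) (copiesE k EF)"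
proof -
  define m where "m = n - k + 1"
  obtain H where H: "graph {..<m} H" "\<not> contains VF EF {..<m} H" "card H = ex m VF EF"
    using EXgraphs_nonempty[OF assms(2), of m VF] by (auto simp: EXgraphs_def)
  \<comment> \<open>The last \<open>k - 1\<close> vertices, so that \<open>H\<close> already lives
    on the complement \<open>{..<m}\<close>; only the size of \<open>T\<close> matters for the edge
    count.\<close>
  define T where "T = {m..<n}"
  have T: "T \<subseteq> {..<n}" "card T = k - 1" "{..<n} - T = {..<m}" "finite T"
    using assms(5,6) by (auto simp: T_def m_def)
  let ?E = "H \<union> star_edges n T"
  have g: "graph {..<n} ?E"
    unfolding graph_def
  proof (intro conjI ballI)
    fix e assume "e \<in> ?E"
    then show "\<exists>u v. u \<in> {..<n} \<and> v \<in> {..<n} \<and> u \<noteq> v \<and> e = {u, v}"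
    proof
      assume "e \<in> H"
      then obtain u v where uv: "u < m" "v < m" "u \<noteq> v" "e = {u, v}"
        using H(1) by (auto simp: graph_def)
      then show ?thesis using assms(5,6) by (intro exI[of _ u] exI[of _ v]) (auto simp: m_def)
    next
      assume "e \<in> star_edges n T"
      then obtain u v where "e = {u, v}" "u \<in> T" "v \<in> {..<n}" "u \<noteq> v"
        by (auto simp: star_edges_def)
      then show ?thesis using T(1) by (intro exI[of _ u] exI[of _ v]) auto
    qed
  qed simp
  have sub: "e \<notin> star_edges n T" if "e \<subseteq> {..<m}" for e
    using that T(3) by (auto simp: star_edges_def)
  then have "induced {..<m} ?E \<subseteq> H" by (auto simp: induced_def)
  then have "\<not> contains VF EF ({..<n} - T) ?E"
    unfolding T(3) using H(2) contains_induced[OF assms(1)] contains_mono[OF _ order_refl] by metis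
  then have "\<not> contains (copiesV k VF) (copiesE k EF) {..<n} ?E"
    using T assms(5) by (intro not_contains_copies_of_small_cover) auto
  from card_le_ex[OF g this] have "card ?E \<le> ex n (copiesV k VF) (copiesE k EF)" .
  moreover have "card ?E = card H + card (star_edges n T)"
    using sub graph_edge_subset[OF H(1)] graph_finite_edges[OF H(1)] finite_star_edges[OF T(1)]
    by (intro card_Un_disjoint) auto
  ultimately show ?thesis
    using H(3) card_star_edges[OF T(1)] card_star_edges[OF assms(3)] T(2) assms(4) by (simp add: m_def)
qed

text \<open>Each of the \<open>k - 1\<close> join vertices has \<open>n - k + 1\<close> edges to the
  rest, against a Turan increment of at most \<open>(1 - 1 / r) * n + 1\<close>. The surplus is
  about \<open>n / r\<close> each; \<open>k + k * k\<close> absorbs the error.\<close>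

lemma ex_copies_lower_bound:
  fixes C :: real
  assumes "r > 0" "graph VF EF" "EF \<noteq> {}" "1 \<le> k" "k \<le> n"
    and near: "\<And>n. \<bar>real (ex n VF EF) - card (turan_edges n r)\<bar> \<le> C"
  shows "card (turan_edges n r) + (real k - 1) * n / r - (C + k + k * k)
    \<le> ex n (copiesV k VF) (copiesE k EF)"
proof -
  define m where "m = n - k + 1"
  define j where "j = k - 1"
  have n: "n = m + j" and k: "k = Suc j" using assms(4,5) by (simp_all add: m_def j_def)
  have "ex m VF EF + card (star_edges n {..<j}) \<le> ex n (copiesV k VF) (copiesE k EF)"
    unfolding m_def using assms(2-5) by (intro ex_copies_ge) (auto simp: j_def)
  moreover have "j * m \<le> card (star_edges n {..<j})"
    using card_star_edges_ge[of "{..<j}" n] by (simp add: n)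
  ultimately have "ex m VF EF + j * m \<le> ex n (copiesV k VF) (copiesE k EF)" by linarith
  then have "real (ex m VF EF + j * m) \<le> ex n (copiesV k VF) (copiesE k EF)" by (rule of_nat_mono)
  then have 1: "real (ex m VF EF) + real j * m \<le> ex n (copiesV k VF) (copiesE k EF)" by simp
  have 2: "real (card (turan_edges n r)) \<le> real (card (turan_edges m r)) + real j * ((1 - 1 / real r) * real n + 1)"
    using card_turan_edges_add(2)[OF assms(1), of m j] by (simp add: n)
  have 3: "real j * m = real j * n - real j * j" by (simp add: n algebra_simps)
  have 4: "real j * ((1 - 1 / real r) * real n + 1) = real j * n - real j * n / r + j"
    by (simp add: algebra_simps)
  have "real j * j \<le> real k * k" by (intro mult_mono) (simp_all add: k)
  moreover have "(real k - 1) * n / r = real j * n / r" by (simp add: k)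
  ultimately show ?thesis using 1 2 3 4 near[of m] k by simp
qed

text \<open>The edges off \<open>S\<close> number at most \<open>ex (n - k + 1) VF EF\<close>, the
  others lie in the star at \<open>S\<close>. By \<open>ex_copies_ge\<close> the total reaches the
  sum of both bounds, so both are attained.\<close>

lemma join_structure_of_free_complement:
  assumes "graph VF EF" "EF \<noteq> {}" "1 \<le> k" "k \<le> n"
    and G: "graph {..<n} E" "card E = ex n (copiesV k VF) (copiesE k EF)"
    and S: "S \<subseteq> {..<n}" "card S = k - 1" "\<not> contains VF EF ({..<n} - S) E"
  shows "\<exists>G' f. G' \<in> EXgraphs (n - k + 1) VF EF \<and> bij_betw f ({..<n} - S) {..<n - k + 1}
    \<and> E = star_edges n S \<union> {e. e \<subseteq> {..<n} - S \<and> f ` e \<in> G'}"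
proof -
  define A where "A = {..<n} - S"
  define I where "I = induced A E"
  have finS: "finite S" using S(1) by (rule finite_subset) simp
  have cardA: "card A = n - k + 1"
    using S(1,2) finS assms(3,4) by (simp add: A_def card_Diff_subset)
  have gI: "graph A I" unfolding I_def by (rule graph_induced[OF G(1)]) (auto simp: A_def)
  have I_le: "card I \<le> ex (n - k + 1) VF EF"
    using card_induced_le_ex[OF G(1) _ S(3)] cardA by (auto simp: A_def I_def)
  have rest: "E - I \<subseteq> star_edges n S"
  proof
    fix e assume e: "e \<in> E - I"
    then obtain u v where uv: "u \<in> {..<n}" "v \<in> {..<n}" "u \<noteq> v" "e = {u, v}"
      using G(1) by (auto simp: graph_def)
    then have "u \<in> S \<or> v \<in> S" using e by (auto simp: I_def induced_def A_def)
    then show "e \<in> star_edges n S"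
    proof
      assume "u \<in> S"
      then show ?thesis using uv by (auto simp: star_edges_def)
    next
      assume "v \<in> S"
      moreover have "e = {v, u}" using uv(4) by (simp add: insert_commute)
      ultimately show ?thesis using uv by (auto simp: star_edges_def)
    qed
  qed
  have finE: "finite E" using G(1) by (rule graph_finite_edges)
  have IE: "I \<subseteq> E" by (auto simp: I_def induced_def)
  have "card E = card I + card (E - I)"
    using card_Diff_subset[OF finite_subset[OF IE finE] IE] card_mono[OF finE IE] by simp
  moreover have "card (E - I) \<le> card (star_edges n S)"
    using card_mono[OF finite_star_edges[OF S(1)] rest] .
  moreover have "ex (n - k + 1) VF EF + card (star_edges n S) \<le> card E"
    using ex_copies_ge[OF assms(1,2) S(1,2) assms(3,4)] G(2) by simp
  ultimately have card_I: "card I = ex (n - k + 1) VF EF" and "card (E - I) = card (star_edges n S)"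
    using I_le by linarith+
  then have star: "E - I = star_edges n S"
    using card_subset_eq[OF finite_star_edges[OF S(1)] rest] by simp
  have "finite A" by (simp add: A_def)
  then obtain f where f: "bij_betw f A {..<n - k + 1}"
    using ex_bij_betw_finite_nat cardA by (metis atLeast0LessThan)
  then have inj: "inj_on f A" and im: "f ` A = {..<n - k + 1}" by (simp_all add: bij_betw_def)
  define G' where "G' = (`) f ` I"
  have "\<not> contains VF EF A I"
    using S(3) contains_mono[of VF EF A I A E] IE by (auto simp: A_def)
  then have "\<not> contains VF EF {..<n - k + 1} G'"
    using contains_of_contains_image[OF gI inj] unfolding G'_def im by metis
  moreover have "graph {..<n - k + 1} G'"
    using graph_image[OF gI inj] unfolding G'_def im .
  ultimately have "G' \<in> EXgraphs (n - k + 1) VF EF"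
    using card_image_edges[OF gI inj] card_I by (simp add: EXgraphs_def G'_def)
  moreover have "{e. e \<subseteq> A \<and> f ` e \<in> G'} = I"
  proof (intro equalityI subsetI)
    fix e assume "e \<in> {e. e \<subseteq> A \<and> f ` e \<in> G'}"
    then obtain e' where e': "e \<subseteq> A" "e' \<in> I" "f ` e = f ` e'" by (auto simp: G'_def)
    then have "e = e'" using inj_on_image_eq_iff[OF inj e'(1)] graph_edge_subset[OF gI e'(2)] by simp
    then show "e \<in> I" using e'(2) by simp
  qed (use graph_edge_subset[OF gI] in \<open>auto simp: G'_def\<close>)
  then have "E = star_edges n S \<union> {e. e \<subseteq> A \<and> f ` e \<in> G'}" using star IE by blast
  ultimately show ?thesis using f unfolding A_def by blast
qed

theorem theorem1p1:
  fixes r k :: nat and VF :: "'a set" and EF :: "'a set set"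
  assumes "r \<ge> 2" and "k \<ge> 1" and "graph VF EF"
    and "\<exists>C::int. \<forall>n. \<bar>int (ex n VF EF) - int (card (turan_edges n r))\<bar> \<le> C"
  shows "\<exists>n0. \<forall>n \<ge> n0. \<forall>E.
     graph {..<n} E \<and> \<not> contains (copiesV k VF) (copiesE k EF) {..<n} E
       \<and> card E = ex n (copiesV k VF) (copiesE k EF)
     \<longrightarrow> (\<exists>S G' f. S \<subseteq> {..<n} \<and> card S = k - 1 \<and> G' \<in> EXgraphs (n - k + 1) VF EF
            \<and> bij_betw f ({..<n} - S) {..<n - k + 1}
            \<and> E = {{u, v} | u v. u \<in> S \<and> v \<in> {..<n} \<and> u \<noteq> v}
                  \<union> {e. e \<subseteq> {..<n} - S \<and> f ` e \<in> G'})"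
proof -
  obtain C' :: int where C': "\<And>n. \<bar>int (ex n VF EF) - int (card (turan_edges n r))\<bar> \<le> C'"
    using assms(4) by blast
  define C where "C = real_of_int C'"
  have near: "\<bar>real (ex n VF EF) - card (turan_edges n r)\<bar> \<le> C" for n
    using C'[of n] unfolding C_def by linarith
  have r: "r > 0" using assms(1) by simp
  have EF: "EF \<noteq> {}" using edges_nonempty_of_ex_near_turan[OF assms(1,3) near] .
  have finVF: "finite VF" using assms(3) by (rule graph_finite)
  define h where "h = card VF"
  \<comment> \<open>Small enough that a hitting set of \<open>k * h\<close> vertices with excess
    \<open>\<eta> * n\<close> each gains at most \<open>n / (4 * r)\<close>.\<close>
  define \<eta> where "\<eta> = 1 / (4 * real r * (real k * h + 1))"
  \<comment> \<open>The degree deficit tolerated in \<open>contains_avoiding_of_high_degree\<close>;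
    \<open>K\<close> below bounds the number of vertices with a larger one.\<close>
  define \<epsilon> where "\<epsilon> = \<eta> / (2 * r)"
  define C1 where "C1 = C + k + k * k"
  define K where "K = nat \<lceil>(k * h + 1) / \<epsilon>\<rceil>"
  \<comment> \<open>\<open>h\<close> vertices for a copy of \<open>F\<close> off \<open>S\<close>,
    plus \<open>h + 1\<close> for each vertex of \<open>S\<close> in the greedy choice of further
    copies.\<close>
  define M where "M = h + k * (h + 1)"
  have pos: "0 < real k * h + 1" by (simp add: add_nonneg_pos)
  then have \<eta>_pos: "0 < \<eta>" using r unfolding \<eta>_def by (intro divide_pos_pos mult_pos_pos) simp_all
  have "real (k * h) * \<eta> \<le> (real k * h + 1) * \<eta>"
    using \<eta>_pos by (intro mult_right_mono) simp_all
  also have "\<dots> = 1 / (4 * r)" using pos by (simp add: \<eta>_def)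
  finally have \<eta>: "0 < \<eta>" "k * h * \<eta> \<le> 1 / (4 * r)" using \<eta>_pos by simp_all
  have \<epsilon>: "0 < \<epsilon>" using \<eta>(1) r by (simp add: \<epsilon>_def)
  have "(k * h + 1) / \<epsilon> \<le> K" unfolding K_def by linarith
  then have K: "k * h + 1 \<le> K * \<epsilon>" using \<epsilon> by (simp add: field_simps)
  obtain N where N: "\<forall>(D :: nat set) E (q :: real). finite D \<longrightarrow> N \<le> card D \<longrightarrow>
      (\<forall>u\<in>D. card (D - nbhd E u) \<le> q) \<longrightarrow> (real r - 1) * q \<le> (1 - \<eta> / 4) * card D \<longrightarrow>
      (\<exists>P. multipartite E r h P \<and> (\<forall>i<r. P i \<subseteq> D))"
    using exists_multipartite[of "\<eta> / 4" r h] \<eta>(1) by auto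
  \<comment> \<open>The summands provide, in order, \<open>k \<le> n\<close>, the largeness
    conditions of \<open>few_low_degree_vertices\<close> and
    \<open>many_high_degree_vertices\<close>, and the two of
    \<open>contains_avoiding_of_high_degree\<close>; the final \<open>1\<close> gives
    strictness.\<close>
  define n0 where "n0 = k + nat \<lceil>\<bar>real K * K + C + C1\<bar>\<rceil> + nat \<lceil>\<bar>2 * r * ((real (k * h) + k)\<^sup>2 + C + C1)\<bar>\<rceil>
    + nat \<lceil>4 * (real M + K) / \<eta>\<rceil> + 2 * N + 1"
  show ?thesis
  proof (intro exI[of _ n0] allI impI, elim conjE)
    fix n E
    assume n: "n0 \<le> n" and G: "graph {..<n} E" "\<not> contains (copiesV k VF) (copiesE k EF) {..<n} E"
      and ext: "card E = ex n (copiesV k VF) (copiesE k EF)"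
    have "k \<le> n" using n by (simp add: n0_def)
    have large1: "real K * K + C + C1 < card {..<n}"
      using n unfolding n0_def card_lessThan by linarith
    have large2: "2 * r * ((real (k * h) + k)\<^sup>2 + C + C1) < card {..<n}"
      using n unfolding n0_def card_lessThan by linarith
    have "4 * (real M + K) / \<eta> \<le> n"
      using n unfolding n0_def by linarith
    then have large3: "4 * (real M + K) \<le> \<eta> * card {..<n}" using \<eta>(1) by (simp add: field_simps)
    have large4: "2 * N \<le> card {..<n}" using n by (simp add: n0_def)
    have edges: "card (turan_edges (card {..<n}) r) + (real k - 1) * card {..<n} / r - C1 \<le> card E"
      using ex_copies_lower_bound[OF r assms(3) EF assms(2) \<open>k \<le> n\<close> near] ext by (simp add: C1_def)
    moreover have "0 \<le> (real k - 1) * card {..<n} / r" using assms(2) by simp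
    ultimately have edges': "card (turan_edges (card {..<n}) r) - C1 \<le> card E" by linarith
    define L where "L = {v \<in> {..<n}. (1 - 1 / r + \<eta>) * card {..<n} \<le> card (nbhd E v)}"
    have "k - 1 \<le> card L" unfolding L_def
      using many_high_degree_vertices[OF r near finVF G edges _ \<eta>(1)] \<eta>(2) large2 by (simp add: h_def)
    then obtain S where S: "S \<subseteq> L" "card S = k - 1" "finite S"
      by (rule obtain_subset_with_card_n)
    have low: "card {v \<in> {..<n}. card (nbhd E v) < (1 - 1 / r - \<eta> / (2 * real r)) * card {..<n}} \<le> K"
      using few_low_degree_vertices[OF r near finVF G edges' _ large1, of \<epsilon>] K
      by (simp add: h_def \<epsilon>_def less_imp_le)
    have rich: "\<forall>v\<in>S. \<forall>X. finite X \<longrightarrow> v \<notin> X \<longrightarrow> card X \<le> M \<longrightarrow> contains VF EF ({..<n} - X) E"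
    proof (intro ballI allI impI)
      fix v X assume v: "v \<in> S" and X: "finite X" "v \<notin> X" "card X \<le> M"
      have "v \<in> {..<n}" "(1 - 1 / r + \<eta>) * card {..<n} \<le> card (nbhd E v)"
        using v S(1) by (auto simp: L_def)
      from contains_avoiding_of_high_degree[OF assms(1,3) near G(1) \<eta>(1) low N[unfolded h_def] large3 large4 this X]
      show "contains VF EF ({..<n} - X) E" .
    qed
    have SV: "S \<subseteq> {..<n}" using S(1) by (auto simp: L_def)
    have "\<not> contains VF EF ({..<n} - S) E"
    proof
      assume "contains VF EF ({..<n} - S) E"
      then obtain f where f: "inj_on f VF" "f ` VF \<subseteq> {..<n} - S" "\<forall>e\<in>EF. f ` e \<in> E"
        by (rule containsE)
      have "S \<inter> f ` VF = {}" using f(2) by blast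
      moreover have "card (f ` VF) + card S * (card VF + 1) \<le> M"
        using card_image_le[OF finVF, of f] S(2) by (simp add: M_def h_def add_mono mult_le_mono1 del: mult_Suc_right)
      ultimately have "contains (copiesV (card S) VF) (copiesE (card S) EF) ({..<n} - f ` VF) E"
        using contains_copies_of_rich_vertices[OF finVF S(3) rich finite_imageI[OF finVF]] by simp
      moreover have "f ` VF \<subseteq> {..<n}" using f(2) by blast
      ultimately have "contains (copiesV (Suc (card S)) VF) (copiesE (Suc (card S)) EF) {..<n} E"
        using f by (intro contains_copies_Suc[of f])
      moreover have "Suc (card S) = k" using S(2) assms(2) by simp
      ultimately show False using G(2) by simp
    qed
    from join_structure_of_free_complement[OF assms(3) EF assms(2) \<open>k \<le> n\<close> G(1) ext SV S(2) this]
    obtain G' f where "G' \<in> EXgraphs (n - k + 1) VF EF" "bij_betw f ({..<n} - S) {..<n - k + 1}"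
      "E = star_edges n S \<union> {e. e \<subseteq> {..<n} - S \<and> f ` e \<in> G'}"
      by (elim exE conjE)
    then show "\<exists>S G' f. S \<subseteq> {..<n} \<and> card S = k - 1 \<and> G' \<in> EXgraphs (n - k + 1) VF EF
            \<and> bij_betw f ({..<n} - S) {..<n - k + 1}
            \<and> E = {{u, v} | u v. u \<in> S \<and> v \<in> {..<n} \<and> u \<noteq> v}
                  \<union> {e. e \<subseteq> {..<n} - S \<and> f ` e \<in> G'}"
      unfolding star_edges_def using SV S(2) by (intro exI conjI)
  qed
qed

end
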